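(* Let $\phi:\mathbb P^1\to\mathbb P^1$ be a rational map of degree $d\ge 2$ with an automorphism $h\in\mathrm{PGL}_2$ (i.e. $h^{-1}\circ\phi\circ h=\phi$) of prime order $p$. Let $K$ be a field over which $\phi$, $h$, and the points of $\mathrm{Fix}(h)$ are all defined. (a) If $K$ has characteristic $0$, then the dynatomic polynomial $\Phi^*_{pN,\phi}$ is reducible over $K$ for all but finitely many positive integers $N$. (b) For $K$ of arbitrary characteristic, $\Phi^*_{pN,\phi}$ is reducible over $K$ for all but finitely many prime integers $N$.
   Context: Write $\phi(x,y)=[F_1(x,y):G_1(x,y)]$ with $F_1,G_1$ homogeneous of degree $d$ without common factor, and $\phi^N=[F_N:G_N]$ with $F_N=F_{N-1}(F_1,G_1)$, $G_N=G_{N-1}(F_1,G_1)$. Put $\Phi_{N,\phi}=yF_N-xG_N$ and $\Phi^*_{N,\phi}=\prod_{k\mid N}\Phi_{k,\phi}^{\mu(N/k)}$ (a homogeneous polynomial; $\mu$ the Möbius function). $\mathrm{Fix}(h)$ is the set of fixed points of $h$ in $\mathbb P^1(\overline K)$. *)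

theory Defs
  imports
    "HOL-Algebra.Algebraic_Closure_Type"
    "HOL-Algebra.Coset"
    "HOL-Algebra.Multiplicative_Group"
    "HOL-Analysis.Cartesian_Space"
    "HOL-Computational_Algebra.Computational_Algebra"
begin

(* K[x,y] is modelled as K[x][y]: the coefficient of x^i y^j in P is
   coeff (coeff P j) i. *)

type_synonym 'k bipoly = "'k poly poly"

definition const2 :: "'k::field \<Rightarrow> 'k bipoly" where
  "const2 a = [:[:a:]:]"

definition varx :: "'k::field bipoly" where
  "varx = [:[:0, 1:]:]"

definition vary :: "'k::field bipoly" where
  "vary = [:0, 1:]"

definition homogeneous2 :: "nat \<Rightarrow> 'k::field bipoly \<Rightarrow> bool" where
  "homogeneous2 n P \<longleftrightarrow>
     (\<forall>i j. poly.coeff (poly.coeff P j) i \<noteq> 0 \<longrightarrow> i + j = n)"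

(* P(A, B) *)
definition subst2 :: "'k::field bipoly \<Rightarrow> 'k bipoly \<Rightarrow> 'k bipoly \<Rightarrow> 'k bipoly" where
  "subst2 P A B = poly (map_poly (\<lambda>c. poly (map_poly const2 c) A) P) B"

definition reducible2 :: "'k::field bipoly \<Rightarrow> bool" where
  "reducible2 P \<longleftrightarrow> P \<noteq> 0 \<and> \<not> P dvd 1 \<and> \<not> Factorial_Ring.irreducible P"


(* A pair (F, G) stands for the map [F : G]. *)

type_synonym 'k ratmap = "'k bipoly \<times> 'k bipoly"

definition rational_map :: "nat \<Rightarrow> 'k::field ratmap \<Rightarrow> bool" where
  "rational_map d \<phi> \<longleftrightarrow>
     homogeneous2 d (fst \<phi>) \<and> homogeneous2 d (snd \<phi>) \<and> coprime (fst \<phi>) (snd \<phi>)"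

definition ratmap_comp :: "'k::field ratmap \<Rightarrow> 'k ratmap \<Rightarrow> 'k ratmap" where
  "ratmap_comp \<psi> \<phi> =
     (subst2 (fst \<psi>) (fst \<phi>) (snd \<phi>), subst2 (snd \<psi>) (fst \<phi>) (snd \<phi>))"

(* [A : B] = [C : D] as points of the projective line over K(x,y); used only for pairs
   different from (0, 0). *)
definition ratmap_eq :: "'k::field ratmap \<Rightarrow> 'k ratmap \<Rightarrow> bool" where
  "ratmap_eq \<phi> \<psi> \<longleftrightarrow> fst \<phi> * snd \<psi> = snd \<phi> * fst \<psi>"

primrec ratmap_iter :: "'k::field ratmap \<Rightarrow> nat \<Rightarrow> 'k ratmap" where
  "ratmap_iter \<phi> 0 = (varx, vary)"
| "ratmap_iter \<phi> (Suc N) = ratmap_comp (ratmap_iter \<phi> N) \<phi>"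

definition period_poly :: "'k::field ratmap \<Rightarrow> nat \<Rightarrow> 'k bipoly" where
  "period_poly \<phi> N = vary * fst (ratmap_iter \<phi> N) - varx * snd (ratmap_iter \<phi> N)"

definition moebius_mu :: "nat \<Rightarrow> int" where
  "moebius_mu n = (if squarefree n then (-1) ^ card (prime_factors n) else 0)"

(* The product is taken in the field of fractions of K[x,y]; the dynatomic polynomial is
   the polynomial representing it. *)
definition dynatomic :: "'k::field ratmap \<Rightarrow> nat \<Rightarrow> 'k bipoly" where
  "dynatomic \<phi> N =
     (THE P. to_fract P =
        (\<Prod>k | k dvd N. to_fract (period_poly \<phi> k) powi moebius_mu (N div k)))"


definition GL2 :: "('k::field ^ 2 ^ 2) monoid" where
  "GL2 = \<lparr>carrier = {A. invertible A}, monoid.mult = (**), one = mat 1\<rparr>"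

definition scalars2 :: "('k::field ^ 2 ^ 2) set" where
  "scalars2 = {mat c | c. c \<noteq> 0}"

definition PGL2 :: "('k::field ^ 2 ^ 2) set monoid" where
  "PGL2 = GL2 Mod scalars2"

definition pgl_class :: "'k::field ^ 2 ^ 2 \<Rightarrow> ('k ^ 2 ^ 2) set" where
  "pgl_class A = scalars2 #>\<^bsub>GL2\<^esub> A"

definition ratmap_of_matrix :: "'k::field ^ 2 ^ 2 \<Rightarrow> 'k ratmap" where
  "ratmap_of_matrix A =
     (const2 (A $ 1 $ 1) * varx + const2 (A $ 1 $ 2) * vary,
      const2 (A $ 2 $ 1) * varx + const2 (A $ 2 $ 2) * vary)"

definition is_automorphism :: "'k::field ^ 2 ^ 2 \<Rightarrow> 'k ratmap \<Rightarrow> bool" where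
  "is_automorphism A \<phi> \<longleftrightarrow>
     ratmap_eq
       (ratmap_comp (ratmap_of_matrix (matrix_inv A)) (ratmap_comp \<phi> (ratmap_of_matrix A)))
       \<phi>"


(* A point of the projective line is the set of its homogeneous coordinate vectors. *)

definition proj_point :: "'f::field ^ 2 \<Rightarrow> ('f ^ 2) set" where
  "proj_point v = {c *s v | c. c \<noteq> 0}"

definition proj_line :: "('f::field ^ 2) set set" where
  "proj_line = proj_point ` (UNIV - {0})"

definition Fix :: "'k::field ^ 2 ^ 2 \<Rightarrow> ('k alg_closure ^ 2) set set" where
  "Fix A = {P \<in> proj_line. (\<lambda>v. map_matrix to_ac A *v v) ` P = P}"

(* P^1(K) inside the projective line over the algebraic closure *)
definition rational_points :: "('k::field alg_closure ^ 2) set set" where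
  "rational_points = {proj_point (\<chi> i. to_ac (v $ i)) | v :: 'k ^ 2. v \<noteq> 0}"

end

theory Submission
  imports Defs "HOL-Number_Theory.Cong"
begin

text \<open>
  Every solution of \<open>h (\<phi>\<^sup>N P) = P\<close> satisfies \<open>\<phi>\<^bsup>pN\<^esup> P = P\<close>, and these solutions are the
  zeros of a form of degree \<open>d\<^sup>N + 1\<close> over \<open>K\<close>, which is less than the degree of
  \<open>\<Phi>\<^sup>*\<^bsub>pN\<^esub>\<close>. So one common zero with \<open>\<Phi>\<^sup>*\<^bsub>pN\<^esub>\<close> over the algebraic closure
  makes \<open>\<Phi>\<^sup>*\<^bsub>pN\<^esub>\<close> reducible. Suppose there is none. In characteristic 0 the multiplicity of a
  fixed point does not change under iteration once its multiplier is 1; hence every zero \<open>P\<close> is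
  either fixed by \<open>h\<close>, with multiplicity bounded independently of \<open>N\<close>, or a zero of the same
  multiplicity of the fixed point form of some \<open>h\<^sup>a \<circ> \<phi>\<^sup>M\<close> with \<open>M\<close> a proper divisor of \<open>N\<close>.
  Summing over \<open>P\<close> gives \<open>d\<^sup>N + 1 \<le> 2pd\<^bsup>N/2 + 1\<^esup> + C\<close>, which bounds \<open>N\<close>. For a large prime \<open>N\<close>
  all zeros are fixed by \<open>\<phi>\<^sup>p\<close>, with the same multiplicity for \<open>\<phi>\<^sup>p\<close> and \<open>\<phi>\<^bsup>pN\<^esup>\<close> in any
  characteristic, which gives \<open>d\<^sup>N + 1 \<le> d\<^sup>p + 1\<close>. The same local computation shows that the
  product defining \<open>\<Phi>\<^sup>*\<^bsub>pN\<^esub>\<close> is a polynomial.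
\<close>

subsection \<open>Evaluation and homogeneity\<close>

text \<open>The maps \<open>h^a \<circ> \<phi>^n\<close> act on pairs of power series over the
  algebraic closure, and identities such as \<open>h^p = 1\<close> hold only up to a unit factor;
  units do not change orders of vanishing. A point P enters only through its multiplicities as a
  fixed point of these maps. Two thresholds in that table obey a cancellation law: at least 1 (P is
  fixed) and at least 2 (multiplier 1). Above them, the first coefficient in which a local series
  differs from X is multiplied by k in the k-th iterate. So the characteristic enters only through
  the question whether k vanishes in the field. If it does, the multiplicity jumps, which is why
  part (b) is restricted to prime N: among primes only N = char can cause such a jump. Nonnegativity
  of the exponents in the dynatomic product is accordingly proved for all indices in characteristic
  0, and in part (b) only for N outside a finite exceptional set. The term 2p d^(N/2+1) collects the
  p maps \<open>h^a \<circ> \<phi>^M\<close> for each M up to N/2, the p choices of a coming from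
  the order of h; C collects the fixed points of h.\<close>

locale ring_morphism =
  fixes f :: "'a::comm_ring_1 \<Rightarrow> 'b::comm_ring_1"
  assumes zero: "f 0 = 0" and one: "f 1 = 1"
    and add: "f (x + y) = f x + f y" and mult: "f (x * y) = f x * f y"
begin

lemma uminus: "f (- x) = - f x"
  by (metis add add.right_inverse add_eq_0_iff zero)

lemma diff: "f (x - y) = f x - f y"
  by (metis add uminus add_uminus_conv_diff)

lemma power: "f (x ^ n) = f x ^ n"
  by (induction n) (simp_all add: one mult)

lemma sum: "f (sum g A) = (\<Sum>i\<in>A. f (g i))"
  by (induction A rule: infinite_finite_induct) (simp_all add: zero add)

end

definition peval :: "('a::comm_ring_1 \<Rightarrow> 'b::comm_ring_1) \<Rightarrow> 'a poly \<Rightarrow> 'b \<Rightarrow> 'b" where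
  "peval f p x = poly (map_poly f p) x"

lemma peval_0 [simp]: "peval f 0 x = 0"
  by (simp add: peval_def)

context ring_morphism
begin

lemma peval_pCons [simp]: "peval f (pCons a p) x = f a + x * peval f p x"
  by (simp add: peval_def map_poly_pCons zero)

lemma peval_add: "peval f (p + q) x = peval f p x + peval f q x"
  by (induction p q rule: poly_induct2) (simp_all add: zero add algebra_simps)

lemma peval_smult: "peval f (smult c p) x = f c * peval f p x"
  by (induction p) (simp_all add: zero mult algebra_simps)

lemma peval_mult: "peval f (p * q) x = peval f p x * peval f q x"
  by (induction p) (simp_all add: zero peval_add peval_smult algebra_simps)

lemma ring_morphism_peval: "ring_morphism (\<lambda>p. peval f p x)"
  by unfold_locales
    (simp_all add: peval_add peval_mult one_pCons one zero del: pCons_one)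

lemma peval_hom:
  assumes "ring_morphism g"
  shows "g (peval f p x) = peval (\<lambda>a. g (f a)) p (g x)"
proof -
  interpret g: ring_morphism g by fact
  interpret gf: ring_morphism "\<lambda>a. g (f a)"
    by unfold_locales (simp_all add: zero one add mult g.zero g.one g.add g.mult)
  show ?thesis
    by (induction p) (simp_all add: g.zero g.add g.mult)
qed

end

definition eval2 :: "('k::field \<Rightarrow> 'b::comm_ring_1) \<Rightarrow> 'k bipoly \<Rightarrow> 'b \<Rightarrow> 'b \<Rightarrow> 'b" where
  "eval2 f P u v = peval (\<lambda>c. peval f c u) P v"

lemma ring_morphism_eval2: "ring_morphism f \<Longrightarrow> ring_morphism (\<lambda>P. eval2 f P u v)"
  unfolding eval2_def by (intro ring_morphism.ring_morphism_peval)

text \<open>Substitution of forms, reparametrization of power series and passage to the constant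
  coefficient are ring morphisms, so this one law replaces an induction for each of them.\<close>

lemma eval2_hom:
  assumes "ring_morphism f" "ring_morphism g"
  shows "g (eval2 f P u v) = eval2 (\<lambda>a. g (f a)) P (g u) (g v)"
  unfolding eval2_def
  by (simp add: ring_morphism.peval_hom[OF ring_morphism.ring_morphism_peval[OF assms(1)] assms(2)]
      ring_morphism.peval_hom[OF assms])

lemma ring_morphism_const2: "ring_morphism (const2 :: 'k::field \<Rightarrow> _)"
  by unfold_locales (simp_all add: const2_def one_pCons)

lemma ring_morphism_const: "ring_morphism (\<lambda>c :: 'k::field. [:c:])"
  by unfold_locales simp_all

lemma ring_morphism_ac: "ring_morphism (\<lambda>c :: 'k::field. fps_const (to_ac c))"
  by unfold_locales simp_all

lemma ring_morphism_compose: "fps_nth \<beta> 0 = 0 \<Longrightarrow> ring_morphism (\<lambda>a :: 'l::field fps. fps_compose a \<beta>)"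
  by unfold_locales (simp_all add: fps_compose_add_distrib fps_compose_mult_distrib)

lemma subst2_eval2: "subst2 P A B = eval2 const2 P A B"
  by (simp add: subst2_def eval2_def peval_def)

lemma eval2_const2: "ring_morphism f \<Longrightarrow> eval2 f (const2 a) u v = f a"
  by (simp add: eval2_def const2_def ring_morphism.peval_pCons ring_morphism.ring_morphism_peval ring_morphism.zero)

lemma eval2_varx: "ring_morphism f \<Longrightarrow> eval2 f varx u v = u"
  by (simp add: eval2_def varx_def ring_morphism.peval_pCons ring_morphism.ring_morphism_peval ring_morphism.zero ring_morphism.one)

lemma eval2_vary: "ring_morphism f \<Longrightarrow> eval2 f vary u v = v"
  by (simp add: eval2_def vary_def ring_morphism.peval_pCons ring_morphism.ring_morphism_peval ring_morphism.zero ring_morphism.one 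
     one_pCons del: pCons_one)

lemma eval2_subst2:
  assumes "ring_morphism f"
  shows "eval2 f (subst2 P A B) u v = eval2 f P (eval2 f A u v) (eval2 f B u v)"
  unfolding subst2_eval2
  by (subst eval2_hom[OF ring_morphism_const2 ring_morphism_eval2[OF assms]]) (simp add: eval2_const2[OF assms])

section \<open>Forms in two variables and polynomials in one\<close>

definition homogenize :: "nat \<Rightarrow> 'k::field poly \<Rightarrow> 'k bipoly" where
  "homogenize n f = (\<Sum>i\<le>n. const2 (poly.coeff f i) * varx ^ i * vary ^ (n - i))"

text \<open>Setting y = 1 forgets the multiplicity at [1 : 0]. It survives as the gap between the
  degree of the form and that of the polynomial, hence the argument \<open>n\<close> of
  \<open>homogenize\<close>.\<close>

definition dehomogenize :: "'k::field bipoly \<Rightarrow> 'k poly" where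
  "dehomogenize P = eval2 (\<lambda>c. [:c:]) P [:0, 1:] 1"

lemma ring_morphism_dehomogenize: "ring_morphism dehomogenize"
  unfolding dehomogenize_def by (rule ring_morphism_eval2[OF ring_morphism_const])

lemma monom2_eq: "const2 a * varx ^ i * vary ^ j = Polynomial.monom (Polynomial.monom a i) j"
proof -
  have "varx ^ i = [:Polynomial.monom (1::'a) i:]"
    by (induction i) (simp_all add: varx_def monom_Suc one_pCons)
  moreover have "vary ^ j = (Polynomial.monom 1 j :: 'a bipoly)"
    by (induction j) (simp_all add: vary_def monom_Suc)
  ultimately show ?thesis
    by (simp add: const2_def smult_monom)
qed

lemma homogeneous2_coeffD:
  "homogeneous2 n P \<Longrightarrow> i + j \<noteq> n \<Longrightarrow> poly.coeff (poly.coeff P j) i = 0"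
  by (auto simp: homogeneous2_def)

lemma homogeneous2_monom: "homogeneous2 (i + j) (const2 a * varx ^ i * vary ^ j)"
  by (auto simp: homogeneous2_def monom2_eq coeff_monom split: if_splits)

lemma homogeneous2_0: "homogeneous2 n 0"
  by (simp add: homogeneous2_def)

lemma homogeneous2_add: "homogeneous2 n P \<Longrightarrow> homogeneous2 n Q \<Longrightarrow> homogeneous2 n (P + Q)"
  by (auto simp: homogeneous2_def) (metis add.right_neutral)

lemma homogeneous2_diff: "homogeneous2 n P \<Longrightarrow> homogeneous2 n Q \<Longrightarrow> homogeneous2 n (P - Q)"
  by (auto simp: homogeneous2_def) (metis diff_0_right)

lemma homogeneous2_sum: "(\<And>i. i \<in> A \<Longrightarrow> homogeneous2 n (g i)) \<Longrightarrow> homogeneous2 n (sum g A)"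
  by (induction A rule: infinite_finite_induct) (simp_all add: homogeneous2_0 homogeneous2_add)

lemma homogeneous2_mult:
  assumes "homogeneous2 n P" "homogeneous2 m Q"
  shows "homogeneous2 (n + m) (P * Q)"
  unfolding homogeneous2_def
proof (intro allI impI)
  fix i j assume "poly.coeff (poly.coeff (P * Q) j) i \<noteq> 0"
  then obtain j' i' where *: "j' \<le> j" "i' \<le> i"
    "poly.coeff (poly.coeff P j') i' * poly.coeff (poly.coeff Q (j - j')) (i - i') \<noteq> 0"
    by (force simp: coeff_mult coeff_sum elim!: sum.not_neutral_contains_not_neutral)
  then have "i' + j' = n" "(i - i') + (j - j') = m"
    using assms by (auto simp: homogeneous2_def)
  with * show "i + j = n + m" by linarith
qed

lemma homogeneous2_1: "homogeneous2 0 1"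
  using homogeneous2_monom[of 0 0 1] by (simp add: ring_morphism.one[OF ring_morphism_const2])

lemma homogeneous2_const2: "homogeneous2 0 (const2 a)"
  using homogeneous2_monom[of 0 0 a] by simp

lemma homogeneous2_varx: "homogeneous2 1 varx"
  using homogeneous2_monom[of 1 0 1] by (simp add: ring_morphism.one[OF ring_morphism_const2])

lemma homogeneous2_vary: "homogeneous2 1 vary"
  using homogeneous2_monom[of 0 1 1] by (simp add: ring_morphism.one[OF ring_morphism_const2])

lemma homogeneous2_power: "homogeneous2 n P \<Longrightarrow> homogeneous2 (n * k) (P ^ k)"
  by (induction k) (simp_all add: homogeneous2_1 homogeneous2_mult)

lemma homogeneous2_prod:
  "(\<And>i. i \<in> A \<Longrightarrow> homogeneous2 (n i) (g i)) \<Longrightarrow> homogeneous2 (sum n A) (prod g A)"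
  by (induction A rule: infinite_finite_induct) (simp_all add: homogeneous2_1 homogeneous2_mult)

lemma homogeneous2_expand:
  assumes "homogeneous2 n P"
  shows "P = (\<Sum>i\<le>n. const2 (poly.coeff (poly.coeff P (n - i)) i) * varx ^ i * vary ^ (n - i))"
proof (intro poly_eqI)
  fix j i
  have "poly.coeff (poly.coeff P j) i =
     (\<Sum>k\<le>n. if k = i then (if n - k = j then poly.coeff (poly.coeff P (n - k)) k else 0) else 0)"
    using homogeneous2_coeffD[OF assms, of i j] by auto
  also have "\<dots> = (\<Sum>k\<le>n. poly.coeff (poly.coeff (const2 (poly.coeff (poly.coeff P (n - k)) k) * varx ^ k * vary ^ (n - k)) j) i)"
    by (intro sum.cong) (auto simp: monom2_eq coeff_monom)
  finally show "poly.coeff (poly.coeff P j) i = poly.coeff (poly.coeff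
     (\<Sum>i\<le>n. const2 (poly.coeff (poly.coeff P (n - i)) i) * varx ^ i * vary ^ (n - i)) j) i"
    by (simp add: coeff_sum)
qed

lemma eval2_homogeneous:
  assumes "ring_morphism f" "homogeneous2 n P"
  shows "eval2 f P u v = (\<Sum>i\<le>n. f (poly.coeff (poly.coeff P (n - i)) i) * u ^ i * v ^ (n - i))"
proof -
  interpret E: ring_morphism "\<lambda>P. eval2 f P u v" by (rule ring_morphism_eval2[OF assms(1)])
  show ?thesis
    by (subst homogeneous2_expand[OF assms(2)])
      (simp add: E.sum E.mult E.power eval2_const2 eval2_varx eval2_vary assms)
qed

lemma homogeneous2_homogenize: "homogeneous2 n (homogenize n f)"
proof -
  have "homogeneous2 n (const2 (poly.coeff f i) * varx ^ i * vary ^ (n - i))" if "i \<le> n" for i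
    using homogeneous2_monom[of i "n - i" "poly.coeff f i"] that by simp
  then show ?thesis unfolding homogenize_def by (intro homogeneous2_sum) auto
qed

lemma dehomogenize_homogeneous:
  assumes "homogeneous2 n P"
  shows "dehomogenize P = (\<Sum>i\<le>n. Polynomial.monom (poly.coeff (poly.coeff P (n - i)) i) i)"
  unfolding dehomogenize_def eval2_homogeneous[OF ring_morphism_const assms]
  by (simp add: monom_altdef)

lemma coeff_dehomogenize:
  assumes "homogeneous2 n P"
  shows "poly.coeff (dehomogenize P) i = (if i \<le> n then poly.coeff (poly.coeff P (n - i)) i else 0)"
  by (simp add: dehomogenize_homogeneous[OF assms] coeff_sum coeff_monom)

lemma homogenize_dehomogenize: "homogeneous2 n P \<Longrightarrow> homogenize n (dehomogenize P) = P"
  unfolding homogenize_def by (subst (2) homogeneous2_expand, assumption) (simp add: coeff_dehomogenize)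

lemma degree_dehomogenize: "homogeneous2 n P \<Longrightarrow> Polynomial.degree (dehomogenize P) \<le> n"
  by (rule degree_le) (simp add: coeff_dehomogenize)

lemma dehomogenize_homogenize:
  assumes "Polynomial.degree f \<le> n"
  shows "dehomogenize (homogenize n f) = f"
proof -
  interpret D: ring_morphism dehomogenize by (rule ring_morphism_dehomogenize)
  have "dehomogenize (homogenize n f) = (\<Sum>i\<le>n. Polynomial.monom (poly.coeff f i) i)"
    unfolding homogenize_def
    by (simp add: D.sum D.mult D.power, simp add: dehomogenize_def eval2_const2 eval2_varx eval2_vary ring_morphism_const)
       (simp add: monom_altdef)
  also have "\<dots> = f" by (rule poly_as_sum_of_monoms'[OF assms])
  finally show ?thesis .
qed

text \<open>\<open>dehomogenize\<close> is multiplicative, and a form of known degree is recovered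
  from its image.\<close>

lemma homogenize_mult:
  assumes "Polynomial.degree f \<le> n" "Polynomial.degree g \<le> m"
  shows "homogenize (n + m) (f * g) = homogenize n f * homogenize m g"
proof -
  have "homogenize n f * homogenize m g = homogenize (n + m) (dehomogenize (homogenize n f * homogenize m g))"
    by (intro homogenize_dehomogenize[symmetric] homogeneous2_mult homogeneous2_homogenize)
  also have "dehomogenize (homogenize n f * homogenize m g) = f * g"
    by (simp add: ring_morphism.mult[OF ring_morphism_dehomogenize] dehomogenize_homogenize assms)
  finally show ?thesis ..
qed

lemma dehomogenize_eq_0_iff: "homogeneous2 n P \<Longrightarrow> dehomogenize P = 0 \<longleftrightarrow> P = 0"
  using homogenize_dehomogenize[of n P] by (auto simp: homogenize_def ring_morphism.zero[OF ring_morphism_dehomogenize] ring_morphism.zero[OF ring_morphism_const2])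

lemma homogeneous2_not_unit:
  assumes "homogeneous2 n P" "n > 0"
  shows "\<not> P dvd 1"
proof
  assume "P dvd 1"
  then obtain c where "c dvd 1" "P = [:c:]" by (auto simp: is_unit_poly_iff)
  then obtain b where b: "b dvd 1" "P = [:[:b:]:]" by (auto simp: is_unit_poly_iff)
  then have "poly.coeff (poly.coeff P 0) 0 \<noteq> 0" by auto
  then show False using assms by (force simp: homogeneous2_def)
qed

subsection \<open>Power series maps near a fixed point\<close>

text \<open>An element is a formal arc in homogeneous coordinates; if it is
  \<open>nonvanishing\<close>, its value at X = 0 is a point of the projective line.\<close>

type_synonym 'l fvec = "'l fps \<times> 'l fps"

definition smul :: "'l::field fps \<Rightarrow> 'l fvec \<Rightarrow> 'l fvec" where
  "smul c V = (c * fst V, c * snd V)"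

definition vcomp :: "'l::field fvec \<Rightarrow> 'l fps \<Rightarrow> 'l fvec" where
  "vcomp V \<beta> = (fps_compose (fst V) \<beta>, fps_compose (snd V) \<beta>)"

definition nonvanishing :: "'l::field fvec \<Rightarrow> bool" where
  "nonvanishing V \<longleftrightarrow> fps_nth (fst V) 0 \<noteq> 0 \<or> fps_nth (snd V) 0 \<noteq> 0"

definition vdet :: "'l::field fvec \<Rightarrow> 'l fvec \<Rightarrow> 'l fps" where
  "vdet V W = snd W * fst V - fst W * snd V"

text \<open>The three facts about a base-point-free form map that local computations need. Stated
  for functions on arcs, they pass to composites and iterates without any resultant or coprimality
  argument.\<close>

definition homog_map :: "nat \<Rightarrow> ('l::field fvec \<Rightarrow> 'l fvec) \<Rightarrow> bool" where
  "homog_map D T \<longleftrightarrow>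
     (\<forall>c V. T (smul c V) = smul (c ^ D) (T V)) \<and>
     (\<forall>\<beta> V. fps_nth \<beta> 0 = 0 \<longrightarrow> T (vcomp V \<beta>) = vcomp (T V) \<beta>) \<and>
     (\<forall>V. nonvanishing V \<longrightarrow> nonvanishing (T V))"

lemma homog_map_smul: "homog_map D T \<Longrightarrow> T (smul c V) = smul (c ^ D) (T V)"
  and homog_map_vcomp: "homog_map D T \<Longrightarrow> fps_nth \<beta> 0 = 0 \<Longrightarrow> T (vcomp V \<beta>) = vcomp (T V) \<beta>"
  and homog_map_nonvanishing: "homog_map D T \<Longrightarrow> nonvanishing V \<Longrightarrow> nonvanishing (T V)"
  unfolding homog_map_def by blast+

lemma smul_smul: "smul a (smul b V) = smul (a * b) V"
  by (simp add: smul_def algebra_simps)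

lemma smul_1 [simp]: "smul 1 V = V"
  by (simp add: smul_def)

lemma vcomp_smul: "fps_nth \<beta> 0 = 0 \<Longrightarrow> vcomp (smul c V) \<beta> = smul (fps_compose c \<beta>) (vcomp V \<beta>)"
  by (simp add: vcomp_def smul_def fps_compose_mult_distrib)

lemma vcomp_vcomp:
  "fps_nth \<alpha> 0 = 0 \<Longrightarrow> fps_nth \<beta> 0 = 0 \<Longrightarrow> vcomp (vcomp V \<alpha>) \<beta> = vcomp V (fps_compose \<alpha> \<beta>)"
  by (simp add: vcomp_def fps_compose_assoc)

lemma homog_map_id: "homog_map 1 (\<lambda>V. V)"
  by (simp add: homog_map_def)

lemma homog_map_comp:
  assumes "homog_map D' T'" "homog_map D T"
  shows "homog_map (D' * D) (\<lambda>V. T' (T V))"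
  unfolding homog_map_def
  by (intro conjI allI impI)
    (simp_all only: homog_map_smul[OF assms(1)] homog_map_smul[OF assms(2)] homog_map_vcomp[OF assms(1)]
      homog_map_vcomp[OF assms(2)] homog_map_nonvanishing[OF assms(1)] homog_map_nonvanishing[OF assms(2)] mult.commute[of D'] power_mult)

lemma homog_map_funpow: "homog_map D T \<Longrightarrow> homog_map (D ^ k) (T ^^ k)"
proof (induction k)
  case 0
  then show ?case using homog_map_id by (simp add: id_def)
next
  case (Suc k)
  then show ?case using homog_map_comp[of D T "D ^ k" "T ^^ k"] by (simp add: comp_def)
qed

text \<open>
  A point of the projective line is \<open>Some a\<close> for \<open>[a : 1]\<close> and \<open>None\<close> for \<open>[1 : 0]\<close>; \<open>param P\<close> is the
  line \<open>v + X w\<close> through a coordinate vector \<open>v\<close> of \<open>P\<close>, so \<open>X\<close> is a local coordinate at \<open>P\<close>.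
\<close>

definition param :: "'l::field option \<Rightarrow> 'l fvec" where
  "param P = (case P of Some a \<Rightarrow> (fps_const a + fps_X, 1) | None \<Rightarrow> (1, fps_X))"

lemma nonvanishing_param: "nonvanishing (param P)"
  by (auto simp: nonvanishing_def param_def split: option.splits)

text \<open>The determinant of T(v) and v, with the sign of yF - xG. Its order in X is the
  multiplicity of P as a fixed point of T.\<close>

definition fix_det :: "'l::field option \<Rightarrow> ('l fvec \<Rightarrow> 'l fvec) \<Rightarrow> 'l fps" where
  "fix_det P T = vdet (T (param P)) (param P)"

text \<open>Stated by vanishing coefficients and not by \<open>subdegree\<close>, because the
  determinant of the identity is 0, whose \<open>subdegree\<close> is 0 although its order is
  infinite.\<close>

definition fix_order_ge :: "'l::field option \<Rightarrow> nat \<Rightarrow> ('l fvec \<Rightarrow> 'l fvec) \<Rightarrow> bool" where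
  "fix_order_ge P j T \<longleftrightarrow> (\<forall>i<j. fps_nth (fix_det P T) i = 0)"

text \<open>\<open>local_series P T \<alpha>\<close>: the map \<open>T\<close> fixes \<open>P\<close> and is \<open>\<alpha>\<close> in the local coordinate at \<open>P\<close>.\<close>

definition local_series :: "'l::field option \<Rightarrow> ('l fvec \<Rightarrow> 'l fvec) \<Rightarrow> 'l fps \<Rightarrow> bool" where
  "local_series P T \<alpha> \<longleftrightarrow> fps_nth \<alpha> 0 = 0 \<and> (\<exists>u. fps_nth u 0 \<noteq> 0 \<and> T (param P) = smul u (vcomp (param P) \<alpha>))"

text \<open>Equality of the induced maps on points. The unit \<open>c\<close> may depend on the
  arc.\<close>

definition same_map :: "('l::field fvec \<Rightarrow> 'l fvec) \<Rightarrow> ('l fvec \<Rightarrow> 'l fvec) \<Rightarrow> bool" where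
  "same_map T T' \<longleftrightarrow> (\<forall>V. nonvanishing V \<longrightarrow> (\<exists>c. fps_nth c 0 \<noteq> 0 \<and> T V = smul c (T' V)))"

lemma low_mult:
  fixes u \<gamma> :: "'l::field fps"
  assumes "\<forall>i<j. fps_nth \<gamma> i = 0"
  shows "\<forall>i<j. fps_nth (u * \<gamma>) i = 0"
  using assms by (auto simp: fps_mult_nth intro!: sum.neutral)

lemma low_mult_unit:
  fixes u \<gamma> :: "'l::field fps"
  assumes "fps_nth u 0 \<noteq> 0"
  shows "(\<forall>i<j. fps_nth (u * \<gamma>) i = 0) \<longleftrightarrow> (\<forall>i<j. fps_nth \<gamma> i = 0)"
proof
  assume "\<forall>i<j. fps_nth (u * \<gamma>) i = 0"
  then have "\<forall>i<j. fps_nth (inverse u * (u * \<gamma>)) i = 0" by (rule low_mult)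
  moreover have "inverse u * (u * \<gamma>) = \<gamma>"
    using inverse_mult_eq_1[OF assms] by (simp add: mult.assoc[symmetric])
  ultimately show "\<forall>i<j. fps_nth \<gamma> i = 0" by simp
qed (rule low_mult)

text \<open>On the line v + X w, the determinant of v + \<alpha> w and v + X w is \<alpha> - X up to
  the constant det(v, w), which is 1 or -1 for \<open>param\<close>.\<close>

lemma fix_det_local_series:
  assumes "local_series P T \<alpha>"
  obtains u where "fps_nth u 0 \<noteq> 0" "fix_det P T = u * (\<alpha> - fps_X)"
proof -
  from assms obtain u where u: "fps_nth u 0 \<noteq> 0" "T (param P) = smul u (vcomp (param P) \<alpha>)"
    and a0: "fps_nth \<alpha> 0 = 0" by (auto simp: local_series_def)
  show ?thesis
  proof (cases P)
    case None
    then have "fix_det P T = (- u) * (\<alpha> - fps_X)"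
      using u a0 by (simp add: fix_det_def vdet_def param_def smul_def vcomp_def algebra_simps)
    moreover have "fps_nth (- u) 0 \<noteq> 0" using u by simp
    ultimately show ?thesis using that by blast
  next
    case (Some a)
    then have "fix_det P T = u * (\<alpha> - fps_X)"
      using u a0 by (simp add: fix_det_def vdet_def param_def smul_def vcomp_def
          fps_compose_add_distrib algebra_simps)
    then show ?thesis using u that by blast
  qed
qed

lemma fix_order_ge_local_series: "local_series P T \<alpha> \<Longrightarrow> fix_order_ge P j T \<longleftrightarrow> (\<forall>i<j. fps_nth (\<alpha> - fps_X) i = 0)"
  by (metis fix_det_local_series low_mult_unit fix_order_ge_def)

lemma local_series_0: "local_series P T \<alpha> \<Longrightarrow> fps_nth \<alpha> 0 = 0"
  by (simp add: local_series_def)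

lemma fix_order_ge1_local_series: "local_series P T \<alpha> \<Longrightarrow> fix_order_ge P 1 T"
  by (simp add: fix_order_ge_local_series local_series_0)

lemma fix_order_ge2_local_series: "local_series P T \<alpha> \<Longrightarrow> fix_order_ge P 2 T \<longleftrightarrow> fps_nth \<alpha> 1 = 1"
  by (auto simp: fix_order_ge_local_series local_series_0 less_2_cases_iff)

text \<open>The image arc starts at P, so the coordinate normalized to 1 in \<open>param P\<close>
  is a unit on it; dividing by that unit puts the image back on the line
  \<open>param P\<close>.\<close>

lemma local_series_exists:
  assumes "homog_map D T" "fix_order_ge P 1 T"
  obtains \<alpha> where "local_series P T \<alpha>"
proof -
  obtain A B where AB: "T (param P) = (A, B)" by (cases "T (param P)")
  have AB0: "fps_nth A 0 \<noteq> 0 \<or> fps_nth B 0 \<noteq> 0"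
    using homog_map_nonvanishing[OF assms(1) nonvanishing_param[of P]] AB by (simp add: nonvanishing_def)
  have z: "fps_nth (fix_det P T) 0 = 0" using assms(2) by (simp add: fix_order_ge_def)
  show ?thesis
  proof (cases P)
    case None
    then have "fps_nth B 0 = 0" using z AB by (simp add: fix_det_def vdet_def param_def)
    with AB0 have A: "fps_nth A 0 \<noteq> 0" by simp
    have "local_series P T (inverse A * B)"
      using None AB A \<open>fps_nth B 0 = 0\<close> inverse_mult_eq_1'[OF A]
      by (auto simp: local_series_def smul_def vcomp_def param_def mult.assoc[symmetric] intro!: exI[of _ A])
    then show ?thesis by (rule that)
  next
    case (Some a)
    then have *: "fps_nth A 0 = a * fps_nth B 0" using z AB by (simp add: fix_det_def vdet_def param_def)
    with AB0 have B: "fps_nth B 0 \<noteq> 0" by auto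
    have "local_series P T (inverse B * A - fps_const a)"
      using Some AB B * inverse_mult_eq_1'[OF B]
      by (auto simp: local_series_def smul_def vcomp_def param_def fps_compose_add_distrib
          mult.assoc[symmetric] intro!: exI[of _ B])
    then show ?thesis by (rule that)
  qed
qed

lemma local_series_comp:
  assumes "homog_map D' T'" "local_series P T \<alpha>" "local_series P T' \<alpha>'"
  shows "local_series P (\<lambda>V. T' (T V)) (fps_compose \<alpha>' \<alpha>)"
proof -
  from assms obtain u u' where u: "fps_nth u 0 \<noteq> 0" "T (param P) = smul u (vcomp (param P) \<alpha>)"
    and u': "fps_nth u' 0 \<noteq> 0" "T' (param P) = smul u' (vcomp (param P) \<alpha>')" by (auto simp: local_series_def)
  note z = local_series_0[OF assms(2)] local_series_0[OF assms(3)]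
  have "T' (T (param P)) = smul (u ^ D' * fps_compose u' \<alpha>) (vcomp (param P) (fps_compose \<alpha>' \<alpha>))"
    using z by (simp add: u u' homog_map_smul[OF assms(1)] homog_map_vcomp[OF assms(1)] vcomp_smul
        vcomp_vcomp smul_smul)
  moreover have "fps_nth (u ^ D' * fps_compose u' \<alpha>) 0 \<noteq> 0"
    using u u' by (simp add: fps_nth_power_0)
  ultimately show ?thesis using z unfolding local_series_def by (auto simp del: fps_mult_nth_0)
qed

text \<open>\<open>T'\<close> is not yet known to fix P and so has no local series; the constant
  terms of the two determinants are compared directly and differ by a power of the nonzero constant
  term of u.\<close>

lemma fix_order_ge1_cancel:
  assumes "homog_map D' T'" "homog_map D T" "fix_order_ge P 1 T" "fix_order_ge P 1 (\<lambda>V. T' (T V))"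
  shows "fix_order_ge P 1 T'"
proof -
  obtain \<alpha> where l: "local_series P T \<alpha>" using local_series_exists[OF assms(2,3)] .
  then obtain u where u: "fps_nth u 0 \<noteq> 0" "T (param P) = smul u (vcomp (param P) \<alpha>)"
    by (auto simp: local_series_def)
  have *: "T' (T (param P)) = smul (u ^ D') (vcomp (T' (param P)) \<alpha>)"
    using local_series_0[OF l] by (simp add: u homog_map_smul[OF assms(1)] homog_map_vcomp[OF assms(1)])
  have "fps_nth (fix_det P (\<lambda>V. T' (T V))) 0 = fps_nth u 0 ^ D' * fps_nth (fix_det P T') 0"
    by (simp add: fix_det_def vdet_def * smul_def vcomp_def fps_nth_power_0 algebra_simps)
  then show ?thesis using assms(4) u by (simp add: fix_order_ge_def)
qed

lemma nth1_compose:
  fixes \<alpha> \<beta> :: "'l::field fps"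
  assumes "fps_nth \<beta> 0 = 0"
  shows "fps_nth (fps_compose \<alpha> \<beta>) 1 = fps_nth \<alpha> 1 * fps_nth \<beta> 1"
  using assms by (simp add: fps_compose_nth)

text \<open>For j = 2 this is the chain rule: the multiplier of the composite is the product of the
  multipliers, and that of \<open>T\<close> is 1.\<close>

lemma fix_order_ge_comp:
  assumes "homog_map D' T'" "homog_map D T" "fix_order_ge P j T" "j \<in> {1, 2}"
  shows "fix_order_ge P j (\<lambda>V. T' (T V)) \<longleftrightarrow> fix_order_ge P j T'"
proof -
  have "fix_order_ge P 1 T" using assms(3,4) by (auto simp: fix_order_ge_def)
  then obtain \<alpha> where l: "local_series P T \<alpha>" using local_series_exists[OF assms(2)] by blast
  show ?thesis
  proof (cases "fix_order_ge P 1 T'")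
    case True
    then obtain \<alpha>' where l': "local_series P T' \<alpha>'" using local_series_exists[OF assms(1)] by blast
    note l'' = local_series_comp[OF assms(1) l l']
    show ?thesis
    proof (cases "j = 1")
      case True
      then show ?thesis using \<open>fix_order_ge P 1 T'\<close> fix_order_ge1_local_series[OF l''] by simp
    next
      case False
      then have "j = 2" using assms(4) by simp
      then show ?thesis using assms(3) l l'
        by (simp add: fix_order_ge2_local_series[OF l''] fix_order_ge2_local_series[OF l] fix_order_ge2_local_series[OF l'] nth1_compose local_series_0
            flip: One_nat_def)
    qed
  next
    case False
    then have "\<not> fix_order_ge P 1 (\<lambda>V. T' (T V))"
      using fix_order_ge1_cancel[OF assms(1,2) \<open>fix_order_ge P 1 T\<close>] by blast
    then show ?thesis using False assms(4) by (auto simp: fix_order_ge_def)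
  qed
qed

lemma fix_det_same:
  assumes "same_map T T'"
  obtains c where "fps_nth c 0 \<noteq> 0" "fix_det P T = c * fix_det P T'"
proof -
  from assms obtain c where "fps_nth c 0 \<noteq> 0" "T (param P) = smul c (T' (param P))"
    using nonvanishing_param unfolding same_map_def by blast
  then have "fix_det P T = c * fix_det P T'" "fps_nth c 0 \<noteq> 0"
    by (simp_all add: fix_det_def vdet_def smul_def algebra_simps)
  then show ?thesis using that by blast
qed

lemma fix_order_ge_same: "same_map T T' \<Longrightarrow> fix_order_ge P j T \<longleftrightarrow> fix_order_ge P j T'"
  by (metis fix_det_same low_mult_unit fix_order_ge_def)

text \<open>Up to the first order in which \<alpha> differs from X, deviations from the identity add
  under composition.\<close>

lemma compose_near_id:
  fixes \<alpha> \<beta> :: "'l::field fps"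
  assumes "fps_nth \<beta> 0 = 0" "fps_nth \<beta> 1 = 1"
    and "\<forall>i<m. fps_nth (\<alpha> - fps_X) i = 0" "i \<le> m"
  shows "fps_nth (fps_compose \<alpha> \<beta> - fps_X) i = fps_nth (\<alpha> - fps_X) i + fps_nth (\<beta> - fps_X) i"
proof -
  have *: "fps_compose \<alpha> \<beta> - fps_X = fps_compose (\<alpha> - fps_X) \<beta> + (\<beta> - fps_X)"
    using assms(1) by (simp add: fps_compose_sub_distrib)
  have "fps_nth (fps_compose (\<alpha> - fps_X) \<beta>) i = (\<Sum>j=0..i. fps_nth (\<alpha> - fps_X) j * fps_nth (\<beta> ^ j) i)"
    by (simp add: fps_compose_nth)
  \<comment> \<open>Terms with j < i vanish since then j < m. In the remaining one, \<beta>^i starts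
    with X^i with coefficient 1.\<close>
  also have "\<dots> = (\<Sum>j\<in>{i}. fps_nth (\<alpha> - fps_X) j * fps_nth (\<beta> ^ j) i)"
    using assms(3,4) by (intro sum.mono_neutral_right) auto
  also have "\<dots> = fps_nth (\<alpha> - fps_X) i"
    using assms(1,2) by (simp add: startsby_zero_power_nth_same)
  finally show ?thesis unfolding * by simp
qed

section \<open>Iterates of a local series\<close>

fun citer :: "'l::field fps \<Rightarrow> nat \<Rightarrow> 'l fps" where
  "citer \<alpha> 0 = fps_X"
| "citer \<alpha> (Suc k) = fps_compose \<alpha> (citer \<alpha> k)"

lemma citer_0: "fps_nth \<alpha> 0 = 0 \<Longrightarrow> fps_nth (citer \<alpha> k) 0 = 0"
  by (induction k) auto

lemma citer_1: "fps_nth \<alpha> 0 = 0 \<Longrightarrow> fps_nth (citer \<alpha> k) 1 = fps_nth \<alpha> 1 ^ k"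
  by (induction k) (auto simp: nth1_compose citer_0 simp flip: One_nat_def)

text \<open>The only place where the characteristic acts: the leading deviation of the k-th iterate
  is k times the original, so the order stays the same exactly when k does not kill it.\<close>

lemma citer_near_id:
  assumes "fps_nth \<alpha> 0 = 0" "fps_nth \<alpha> 1 = 1" "\<forall>i<m. fps_nth (\<alpha> - fps_X) i = 0" "i \<le> m"
  shows "fps_nth (citer \<alpha> k - fps_X) i = of_nat k * fps_nth (\<alpha> - fps_X) i"
proof (induction k)
  case (Suc k)
  have "fps_nth (citer \<alpha> (Suc k) - fps_X) i =
      fps_nth (\<alpha> - fps_X) i + fps_nth (citer \<alpha> k - fps_X) i"
    unfolding citer.simps
    by (rule compose_near_id[OF citer_0[OF assms(1)] _ assms(3,4)])
      (simp add: citer_1 assms del: One_nat_def)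
  then show ?case unfolding Suc by (simp add: algebra_simps del: fps_sub_nth citer.simps)
qed simp

lemma local_series_funpow:
  assumes "homog_map D T" "local_series P T \<alpha>"
  shows "local_series P (T ^^ k) (citer \<alpha> k)"
proof (induction k)
  case 0
  show ?case
    by (auto simp: local_series_def vcomp_def intro!: exI[of _ 1])
next
  case (Suc k)
  then show ?case using local_series_comp[OF assms(1) Suc assms(2)] by (simp add: comp_def)
qed

lemma fix_order_ge_funpow:
  assumes "homog_map D T" "fix_order_ge P j T"
  shows "fix_order_ge P j (T ^^ k)"
proof (cases "j = 0")
  case False
  then have "fix_order_ge P 1 T" using assms(2) by (auto simp: fix_order_ge_def)
  then obtain \<alpha> where l: "local_series P T \<alpha>" using local_series_exists[OF assms(1)] by blast
  note lk = local_series_funpow[OF assms(1) l]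
  show ?thesis
  proof (cases "j = 1")
    case True
    then show ?thesis using fix_order_ge1_local_series[OF lk] by simp
  next
    \<comment> \<open>For j = 1 the multiplier is arbitrary; from here on it is 1, as
      \<open>citer_near_id\<close> demands.\<close>
    case False
    with \<open>j \<noteq> 0\<close> have "j \<ge> 2" by simp
    with assms(2) have "fix_order_ge P 2 T" by (auto simp: fix_order_ge_def)
    then have "fps_nth \<alpha> 1 = 1" using fix_order_ge2_local_series[OF l] by simp
    moreover have j: "\<forall>i<j. fps_nth (\<alpha> - fps_X) i = 0" using assms(2) fix_order_ge_local_series[OF l] by simp
    ultimately show ?thesis
      using citer_near_id[OF local_series_0[OF l] _ j] by (simp add: fix_order_ge_local_series[OF lk])
  qed
qed (simp add: fix_order_ge_def)

text \<open>Coefficient by coefficient: once all lower deviations vanish, the i-th one of the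
  iterate is k times that of \<open>T\<close>, and k is invertible.\<close>

lemma fix_order_ge_funpow_iff:
  assumes "homog_map D T" "fix_order_ge P 2 T" "(of_nat k :: 'l::field) \<noteq> 0"
  shows "fix_order_ge P j (T ^^ k) \<longleftrightarrow> fix_order_ge (P :: 'l option) j T"
proof
  assume vk: "fix_order_ge P j (T ^^ k)"
  have "fix_order_ge P 1 T" using assms(2) by (auto simp: fix_order_ge_def)
  then obtain \<alpha> where l: "local_series P T \<alpha>" using local_series_exists[OF assms(1)] by blast
  note lk = local_series_funpow[OF assms(1) l]
  have a1: "fps_nth \<alpha> 1 = 1" using fix_order_ge2_local_series[OF l] assms(2) by simp
  have "fps_nth (\<alpha> - fps_X) i = 0" if "i < j" for i
    using that
  proof (induction i rule: less_induct)
    case (less i)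
    have "fps_nth (citer \<alpha> k - fps_X) i = of_nat k * fps_nth (\<alpha> - fps_X) i"
      using less by (intro citer_near_id[where m = i] local_series_0[OF l] a1) auto
    moreover have "fps_nth (citer \<alpha> k - fps_X) i = 0"
      using vk less.prems by (simp add: fix_order_ge_local_series[OF lk])
    ultimately show ?case using assms(3) by simp
  qed
  then show "fix_order_ge P j T" by (simp add: fix_order_ge_local_series[OF l])
qed (rule fix_order_ge_funpow[OF assms(1)])

text \<open>\<mu> is the linear coefficient of the local series, and the chain rule gives \<mu>^k
  for the iterate.\<close>

lemma multiplier_exists:
  fixes P :: "'l::field option"
  assumes "homog_map D T" "fix_order_ge P 1 T"
  obtains \<mu> :: 'l where "\<And>k. fix_order_ge P 2 (T ^^ k) \<longleftrightarrow> \<mu> ^ k = 1"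
proof -
  obtain \<alpha> where l: "local_series P T \<alpha>" using local_series_exists[OF assms] .
  have "fix_order_ge P 2 (T ^^ k) \<longleftrightarrow> fps_nth \<alpha> 1 ^ k = 1" for k
    by (simp add: fix_order_ge2_local_series[OF local_series_funpow[OF assms(1) l]] citer_1 local_series_0[OF l] del: One_nat_def)
  then show ?thesis using that[of "fps_nth \<alpha> 1"] by blast
qed

subsection \<open>Multiplicities of points of the projective line\<close>

definition ac_poly :: "'k::field poly \<Rightarrow> 'k alg_closure poly" where
  "ac_poly f = map_poly to_ac f"

lemma coeff_ac_poly [simp]: "poly.coeff (ac_poly f) i = to_ac (poly.coeff f i)"
  by (simp add: ac_poly_def coeff_map_poly)

lemma degree_ac_poly [simp]: "Polynomial.degree (ac_poly f) = Polynomial.degree f"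
  by (simp add: ac_poly_def degree_map_poly)

lemma ac_poly_eq_0_iff [simp]: "ac_poly f = 0 \<longleftrightarrow> f = 0"
  by (simp add: ac_poly_def map_poly_eq_0_iff)

lemma ring_morphism_ac_poly: "ring_morphism ac_poly"
proof
  show "ac_poly 0 = 0" by simp
  show "ac_poly 1 = 1" by (simp add: ac_poly_def)
  show "ac_poly (f + g) = ac_poly f + ac_poly g" for f g by (simp add: poly_eq_iff)
  show "ac_poly (f * g) = ac_poly f * ac_poly g" for f g
    by (simp add: poly_eq_iff coeff_mult to_ac_sum)
qed

text \<open>Division with remainder over K remains one over the closure. The remainder is then
  divisible by \<open>ac_poly b\<close> and has smaller degree, so it is 0.\<close>

lemma ac_poly_dvdD: "ac_poly b dvd ac_poly a \<Longrightarrow> b dvd a"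
proof -
  assume dvd: "ac_poly b dvd ac_poly a"
  interpret A: ring_morphism ac_poly by (rule ring_morphism_ac_poly)
  have "ac_poly a = ac_poly b * ac_poly (a div b) + ac_poly (a mod b)"
    by (metis A.add A.mult mult_div_mod_eq)
  with dvd have d: "ac_poly b dvd ac_poly (a mod b)"
    by (metis dvd_add_right_iff dvd_triv_left)
  have "a mod b = 0"
  proof (cases "b = 0")
    case True
    then show ?thesis using d by (simp add: A.zero)
  next
    case False
    show ?thesis
    proof (rule ccontr)
      assume "a mod b \<noteq> 0"
      then have "Polynomial.degree b \<le> Polynomial.degree (a mod b)"
        using dvd_imp_degree_le[OF d] by simp
      moreover have "Polynomial.degree (a mod b) < Polynomial.degree b"
        using degree_mod_less[of b a] False \<open>a mod b \<noteq> 0\<close> by blast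
      ultimately show False by simp
    qed
  qed
  then show "b dvd a" by (simp add: dvd_eq_mod_eq_0)
qed

lemma alg_closed_factorization_proots:
  fixes p :: "'l::alg_closed_field poly"
  assumes "p \<noteq> 0"
  shows "p = Polynomial.smult (lead_coeff p) (\<Prod>x\<in>#proots p. [:-x, 1:])"
    and "size (proots p) = Polynomial.degree p"
proof -
  obtain A where A: "size A = Polynomial.degree p"
    "p = Polynomial.smult (lead_coeff p) (\<Prod>x\<in>#A. [:-x, 1:])"
    using alg_closed_imp_factorization[OF assms] by blast
  have "proots (\<Prod>x\<in>#A. [:-x, 1:]) = A"
  proof (induction A)
    case (add x A)
    have "(\<Prod>x\<in>#A. [:-x, 1:]) \<noteq> 0" by (auto simp: prod_mset_zero_iff)
    then show ?case using add by (simp add: proots_mult del: mult_pCons_left)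
  qed simp
  then have "proots p = A" using A(2) assms
    by (metis leading_coeff_0_iff proots_smult)
  then show "p = Polynomial.smult (lead_coeff p) (\<Prod>x\<in>#proots p. [:-x, 1:])"
    "size (proots p) = Polynomial.degree p" using A by simp_all
qed

lemma alg_closed_sum_order:
  fixes p :: "'l::alg_closed_field poly"
  assumes "p \<noteq> 0"
  shows "(\<Sum>x | poly p x = 0. Polynomial.order x p) = Polynomial.degree p"
  using alg_closed_factorization_proots(2)[OF assms] assms
  by (simp add: size_multiset_overloaded_eq)

lemma alg_closed_dvd_order:
  fixes p q :: "'l::alg_closed_field poly"
  assumes "p \<noteq> 0" "q \<noteq> 0" "\<And>x. Polynomial.order x p \<le> Polynomial.order x q"
  shows "p dvd q"
proof -
  have "proots p \<subseteq># proots q" using assms by (intro mset_subset_eqI) simp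
  then have "(\<Prod>x\<in>#proots p. [:-x, 1:]) dvd (\<Prod>x\<in>#proots q. [:-x, 1:])"
    by (intro prod_mset_subset_imp_dvd image_mset_subseteq_mono)
  then have "Polynomial.smult (lead_coeff p) (\<Prod>x\<in>#proots p. [:-x, 1:]) dvd
      Polynomial.smult (lead_coeff q) (\<Prod>x\<in>#proots q. [:-x, 1:])"
    using assms by (intro smult_dvd dvd_smult) auto
  then show ?thesis
    using alg_closed_factorization_proots(1)[OF assms(1)]
      alg_closed_factorization_proots(1)[OF assms(2)] by simp
qed

section \<open>Order of vanishing of a form at a point\<close>

definition eval_fps :: "'k::field bipoly \<Rightarrow> 'k alg_closure fvec \<Rightarrow> 'k alg_closure fps" where
  "eval_fps P V = eval2 (\<lambda>c. fps_const (to_ac c)) P (fst V) (snd V)"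

lemma ring_morphism_eval_fps: "ring_morphism (\<lambda>P. eval_fps P V)"
  unfolding eval_fps_def by (rule ring_morphism_eval2[OF ring_morphism_ac])

lemma eval2_scale:
  assumes "ring_morphism f" "homogeneous2 n P"
  shows "eval2 f P (c * u) (c * v) = c ^ n * eval2 f P u v"
  unfolding eval2_homogeneous[OF assms] sum_distrib_left
proof (rule sum.cong[OF refl])
  fix i assume "i \<in> {..n}"
  then have "c ^ n = c ^ i * c ^ (n - i)" by (simp flip: power_add)
  then show "f (poly.coeff (poly.coeff P (n - i)) i) * (c * u) ^ i * (c * v) ^ (n - i) =
      c ^ n * (f (poly.coeff (poly.coeff P (n - i)) i) * u ^ i * v ^ (n - i))"
    by (simp add: power_mult_distrib algebra_simps)
qed

lemma eval_fps_smul: "homogeneous2 n P \<Longrightarrow> eval_fps P (smul c V) = c ^ n * eval_fps P V"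
  by (simp add: eval_fps_def smul_def eval2_scale[OF ring_morphism_ac])

lemma eval_fps_vcomp: "fps_nth \<beta> 0 = 0 \<Longrightarrow> eval_fps P (vcomp V \<beta>) = fps_compose (eval_fps P V) \<beta>"
  by (simp add: eval_fps_def vcomp_def eval2_hom[OF ring_morphism_ac ring_morphism_compose])

lemma eval_fps_nth_0: "fps_nth (eval_fps P V) 0 = eval2 to_ac P (fps_nth (fst V) 0) (fps_nth (snd V) 0)"
proof -
  have "ring_morphism (\<lambda>a :: 'a alg_closure fps. fps_nth a 0)" by unfold_locales simp_all
  from eval2_hom[OF ring_morphism_ac this] show ?thesis by (simp add: eval_fps_def)
qed

lemma ring_morphism_to_ac: "ring_morphism (to_ac :: 'k::field \<Rightarrow> _)"
  by unfold_locales simp_all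

definition point_of :: "'l::field fvec \<Rightarrow> 'l option" where
  "point_of V = (if fps_nth (snd V) 0 = 0 then None
     else Some (fps_nth (fst V) 0 / fps_nth (snd V) 0))"

lemma eval_fps_nth_0_point_of:
  assumes "homogeneous2 n P" "nonvanishing V" "fps_nth (eval_fps P V) 0 = 0"
  shows "fps_nth (eval_fps P (param (point_of V))) 0 = 0"
proof -
  define x y where "x = fps_nth (fst V) 0" and "y = fps_nth (snd V) 0"
  have *: "eval2 to_ac P x y = 0" using assms(3) by (simp add: eval_fps_nth_0 x_def y_def)
  have xy: "x \<noteq> 0 \<or> y \<noteq> 0" using assms(2) by (simp add: nonvanishing_def x_def y_def)
  show ?thesis
  proof (cases "y = 0")
    case True
    then show ?thesis using xy * eval2_scale[OF ring_morphism_to_ac assms(1), of x 1 0]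
      by (simp add: point_of_def y_def[symmetric] eval_fps_nth_0 param_def)
  next
    case False
    then show ?thesis using xy * eval2_scale[OF ring_morphism_to_ac assms(1), of y "x / y" 1]
      by (simp add: point_of_def y_def[symmetric] x_def[symmetric] eval_fps_nth_0 param_def)
  qed
qed

text \<open>Expanding along \<open>param P\<close> treats [1 : 0] like every other point and makes
  \<open>mult_at\<close> of a fixed point form the order of \<open>fix_det\<close>.\<close>

definition mult_at :: "'k::field alg_closure option \<Rightarrow> 'k bipoly \<Rightarrow> nat" where
  "mult_at P H = subdegree (eval_fps H (param P))"

lemma eval_fps_Some: "eval_fps H (param (Some a)) = peval fps_const (ac_poly (dehomogenize H)) (fps_const a + fps_X)"
proof -
  let ?z = "fps_const a + fps_X"
  let ?t = "\<lambda>g. peval (\<lambda>c. fps_const (to_ac c)) g ?z"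
  have "peval fps_const (ac_poly (dehomogenize H)) ?z = ?t (dehomogenize H)"
    by (simp add: peval_def ac_poly_def map_poly_map_poly comp_def)
  also have "\<dots> = eval2 (\<lambda>c. ?t [:c:]) H (?t [:0, 1:]) (?t 1)"
    unfolding dehomogenize_def by (rule eval2_hom[OF ring_morphism_const ring_morphism.ring_morphism_peval[OF ring_morphism_ac]])
  also have "\<dots> = eval_fps H (param (Some a))"
    by (simp add: eval_fps_def param_def ring_morphism.peval_pCons[OF ring_morphism_ac] ring_morphism.one[OF ring_morphism.ring_morphism_peval[OF ring_morphism_ac]])
  finally show ?thesis ..
qed

lemma ring_morphism_fps_const: "ring_morphism (fps_const :: 'l::field \<Rightarrow> _)"
  by unfold_locales simp_all

lemma peval_fps_const_nth_0: "fps_nth (peval fps_const q z) 0 = poly q (fps_nth z 0)" for q :: "'l::field poly"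
  by (induction q) (simp_all add: ring_morphism.peval_pCons[OF ring_morphism_fps_const])

text \<open>Write q = (x - a)^m r with r(a) nonzero. The substitution x = a + X turns the first
  factor into X^m and r into a unit.\<close>

lemma subdegree_peval:
  fixes q :: "'l::field poly"
  assumes "q \<noteq> 0"
  shows "peval fps_const q (fps_const a + fps_X) \<noteq> 0"
    and "subdegree (peval fps_const q (fps_const a + fps_X)) = Polynomial.order a q"
proof -
  let ?z = "fps_const a + fps_X"
  interpret E: ring_morphism "\<lambda>q. peval fps_const q ?z" by (rule ring_morphism.ring_morphism_peval[OF ring_morphism_fps_const])
  obtain r where r: "q = [:-a, 1:] ^ Polynomial.order a q * r" "\<not> [:-a, 1:] dvd r"
    using order_decomp[OF assms] by blast
  have "peval fps_const q ?z = (peval fps_const [:-a, 1:] ?z) ^ Polynomial.order a q * peval fps_const r ?z"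
    by (subst r(1)) (simp only: E.mult E.power)
  also have "peval fps_const [:-a, 1:] ?z = fps_X"
    by (simp add: ring_morphism.peval_pCons[OF ring_morphism_fps_const] flip: fps_const_neg)
  finally have e: "peval fps_const q ?z = fps_X ^ Polynomial.order a q * peval fps_const r ?z" .
  have n0: "fps_nth (peval fps_const r ?z) 0 \<noteq> 0"
    using r(2) by (simp add: peval_fps_const_nth_0 poly_eq_0_iff_dvd)
  then have n0': "peval fps_const r ?z \<noteq> 0" by auto
  then show "peval fps_const q ?z \<noteq> 0" unfolding e by simp
  show "subdegree (peval fps_const q ?z) = Polynomial.order a q"
    unfolding e using n0 n0' by (simp add: subdegree_mult)
qed

text \<open>Along (1, X) the form becomes the reversed polynomial, so its order there is the degree
  defect.\<close>

lemma eval_fps_None_nth: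
  assumes "homogeneous2 n H"
  shows "fps_nth (eval_fps H (param None)) j = (if j \<le> n then to_ac (poly.coeff (dehomogenize H) (n - j)) else 0)"
proof -
  have "fps_nth (eval_fps H (param None)) j =
      (\<Sum>i\<le>n. if n - i = j then to_ac (poly.coeff (poly.coeff H (n - i)) i) else 0)"
    by (auto simp: eval_fps_def param_def eval2_homogeneous[OF ring_morphism_ac assms] fps_sum_nth intro!: sum.cong)
  also have "\<dots> = (\<Sum>i\<le>n. if i = n - j \<and> j \<le> n then to_ac (poly.coeff (poly.coeff H (n - i)) i) else 0)"
    by (intro sum.cong) auto
  also have "\<dots> = (if j \<le> n then to_ac (poly.coeff (dehomogenize H) (n - j)) else 0)"
    by (cases "j \<le> n") (simp_all add: coeff_dehomogenize[OF assms])
  finally show ?thesis .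
qed

lemma mult_at_None:
  assumes "homogeneous2 n H" "H \<noteq> 0"
  shows "eval_fps H (param None) \<noteq> 0" "mult_at None H = n - Polynomial.degree (dehomogenize H)"
proof -
  have d: "dehomogenize H \<noteq> 0" using assms dehomogenize_eq_0_iff by blast
  have le: "Polynomial.degree (dehomogenize H) \<le> n" by (rule degree_dehomogenize[OF assms(1)])
  have *: "fps_nth (eval_fps H (param None)) (n - Polynomial.degree (dehomogenize H)) \<noteq> 0"
    using le d by (simp add: eval_fps_None_nth[OF assms(1)])
  then show "eval_fps H (param None) \<noteq> 0" by auto
  show "mult_at None H = n - Polynomial.degree (dehomogenize H)"
    unfolding mult_at_def using *
    by (intro subdegreeI) (auto simp: eval_fps_None_nth[OF assms(1)] intro!: coeff_eq_0)
qed

lemma mult_at_Some: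
  assumes "homogeneous2 n H" "H \<noteq> 0"
  shows "eval_fps H (param (Some a)) \<noteq> 0" "mult_at (Some a) H = Polynomial.order a (ac_poly (dehomogenize H))"
proof -
  have d: "ac_poly (dehomogenize H) \<noteq> 0" using assms dehomogenize_eq_0_iff by auto
  show "eval_fps H (param (Some a)) \<noteq> 0" "mult_at (Some a) H = Polynomial.order a (ac_poly (dehomogenize H))"
    unfolding mult_at_def eval_fps_Some using subdegree_peval[OF d] by blast+
qed

lemma eval_fps_param_nonzero: "homogeneous2 n H \<Longrightarrow> H \<noteq> 0 \<Longrightarrow> eval_fps H (param P) \<noteq> 0"
  using mult_at_None mult_at_Some by (cases P) blast+

lemma le_mult_at_iff:
  assumes "homogeneous2 n H" "H \<noteq> 0"
  shows "j \<le> mult_at P H \<longleftrightarrow> (\<forall>i<j. fps_nth (eval_fps H (param P)) i = 0)"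
  using eval_fps_param_nonzero[OF assms, of P] unfolding mult_at_def
  by (meson leI nth_less_subdegree_zero nth_subdegree_nonzero order_less_le_trans)

lemma mult_at_mult:
  assumes "homogeneous2 n H" "H \<noteq> 0" "homogeneous2 m G" "G \<noteq> 0"
  shows "mult_at P (H * G) = mult_at P H + mult_at P G"
  using eval_fps_param_nonzero[OF assms(1,2), of P] eval_fps_param_nonzero[OF assms(3,4), of P]
  by (simp add: mult_at_def ring_morphism.mult[OF ring_morphism_eval_fps] subdegree_mult)

lemma mult_at_prod:
  assumes "finite A" "\<And>i. i \<in> A \<Longrightarrow> homogeneous2 (n i) (g i) \<and> g i \<noteq> 0"
  shows "mult_at P (prod g A) = (\<Sum>i\<in>A. mult_at P (g i))"
  using assms
proof (induction A rule: finite_induct)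
  case empty
  then show ?case by (simp add: mult_at_def ring_morphism.one[OF ring_morphism_eval_fps])
next
  case (insert i A)
  have "homogeneous2 (sum n A) (prod g A)" using insert by (intro homogeneous2_prod) auto
  moreover have "prod g A \<noteq> 0" using insert by auto
  ultimately show ?case using insert mult_at_mult[of "n i" "g i" "sum n A" "prod g A" P] by simp
qed

text \<open>The finite roots contribute the degree of the dehomogenization, and [1 : 0] contributes
  exactly the missing part up to n.\<close>

lemma sum_mult_at:
  assumes "homogeneous2 n H" "H \<noteq> 0"
  shows "finite {P. mult_at P H > 0}" (is "finite ?S")
    and "(\<Sum>P | mult_at P H > 0. mult_at P H) = n"
proof -
  define q where "q = ac_poly (dehomogenize H)"
  have d: "q \<noteq> 0" using assms dehomogenize_eq_0_iff by (auto simp: q_def)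
  let ?R = "insert None (Some ` {a. poly q a = 0})"
  have fin: "finite ?R" using poly_roots_finite[OF d] by simp
  have sub: "?S \<subseteq> ?R"
  proof
    fix P assume "P \<in> ?S"
    then show "P \<in> ?R"
      using mult_at_Some(2)[OF assms] d by (cases P) (auto simp: q_def[symmetric] order_gt_0_iff)
  qed
  show "finite ?S" using finite_subset[OF sub fin] .
  have "(\<Sum>P\<in>?S. mult_at P H) = (\<Sum>P\<in>?R. mult_at P H)"
    using sub fin by (intro sum.mono_neutral_left) auto
  also have "\<dots> = mult_at None H + (\<Sum>a | poly q a = 0. mult_at (Some a) H)"
    using fin by (simp add: sum.reindex image_iff finite_image_iff)
  also have "(\<Sum>a | poly q a = 0. mult_at (Some a) H) = Polynomial.degree q"
    using alg_closed_sum_order[OF d] by (simp add: mult_at_Some(2)[OF assms] q_def)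
  also have "mult_at None H + Polynomial.degree q = n"
    using degree_dehomogenize[OF assms(1)] by (simp add: mult_at_None(2)[OF assms] q_def)
  finally show "(\<Sum>P | mult_at P H > 0. mult_at P H) = n" .
qed

lemma sum_mult_at_le:
  assumes "homogeneous2 n H" "H \<noteq> 0" "finite S"
  shows "(\<Sum>P\<in>S. mult_at P H) \<le> n"
proof -
  have "(\<Sum>P\<in>S. mult_at P H) \<le> (\<Sum>P\<in>S \<union> {P. mult_at P H > 0}. mult_at P H)"
    using assms sum_mult_at(1)[OF assms(1,2)] by (intro sum_mono2) auto
  also have "\<dots> = (\<Sum>P | mult_at P H > 0. mult_at P H)"
    using assms sum_mult_at(1)[OF assms(1,2)] by (intro sum.mono_neutral_right) auto
  finally show ?thesis using sum_mult_at(2)[OF assms(1,2)] by simp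
qed

text \<open>The finite points give divisibility over the closure, hence over K. The inequality at
  [1 : 0] keeps the degree of the quotient within n - m, so that it can be homogenized.\<close>

lemma homogeneous2_dvdI:
  assumes "homogeneous2 n A" "A \<noteq> 0" "homogeneous2 m B" "B \<noteq> 0" "\<And>P. mult_at P B \<le> mult_at P A"
  obtains C where "homogeneous2 (n - m) C" "A = B * C" "m \<le> n"
proof -
  define a b where "a = dehomogenize A" and "b = dehomogenize B"
  have nonzero: "a \<noteq> 0" "b \<noteq> 0" using assms dehomogenize_eq_0_iff by (auto simp: a_def b_def)
  have "ac_poly b dvd ac_poly a"
    using nonzero assms(5)[of "Some _"]
    by (intro alg_closed_dvd_order) (auto simp: mult_at_Some[OF assms(1,2)] mult_at_Some[OF assms(3,4)] a_def b_def)
  then obtain c where c: "a = b * c" using ac_poly_dvdD by blast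
  with nonzero have "c \<noteq> 0" by auto
  then have deg: "Polynomial.degree a = Polynomial.degree b + Polynomial.degree c"
    using nonzero by (simp add: c degree_mult_eq)
  have le: "Polynomial.degree a \<le> n" "Polynomial.degree b \<le> m"
    using degree_dehomogenize assms by (auto simp: a_def b_def)
  have "m - Polynomial.degree b \<le> n - Polynomial.degree a"
    using assms(5)[of None] by (simp add: mult_at_None[OF assms(1,2)] mult_at_None[OF assms(3,4)] a_def b_def)
  with le deg have mn: "m \<le> n" "Polynomial.degree c \<le> n - m" by linarith+
  have "A = homogenize (m + (n - m)) (b * c)"
    using homogenize_dehomogenize[OF assms(1)] mn c by (simp add: a_def)
  also have "\<dots> = B * homogenize (n - m) c"
    using homogenize_mult[OF le(2) mn(2)] homogenize_dehomogenize[OF assms(3)] by (simp add: b_def)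
  finally show ?thesis using that homogeneous2_homogenize mn by blast
qed

text \<open>
  Polynomials over an arbitrary field type have no \<open>gcd\<close>; a polynomial of least degree vanishing at
  \<open>a\<close> replaces it.
\<close>

lemma common_root_factor:
  fixes f g :: "'k::field poly"
  assumes "f \<noteq> 0" "poly (ac_poly f) a = 0" "poly (ac_poly g) a = 0"
  obtains c where "c dvd f" "c dvd g" "Polynomial.degree c > 0"
proof -
  let ?Q = "\<lambda>c. c \<noteq> 0 \<and> poly (ac_poly c) a = 0"
  obtain c where c: "?Q c" and min: "\<And>r. ?Q r \<Longrightarrow> Polynomial.degree c \<le> Polynomial.degree r"
    using ex_has_least_nat[of ?Q f Polynomial.degree] assms by blast
  interpret A: ring_morphism "ac_poly :: 'k poly \<Rightarrow> _" by (rule ring_morphism_ac_poly)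
  have dvd: "c dvd r" if "poly (ac_poly r) a = 0" for r
  proof -
    have "ac_poly (r mod c) = ac_poly r - ac_poly (r div c) * ac_poly c"
      by (simp flip: A.mult A.diff add: minus_div_mult_eq_mod)
    then have "poly (ac_poly (r mod c)) a = 0" using that c by simp
    then have "r mod c = 0" using min[of "r mod c"] degree_mod_less[of c r] c by force
    then show ?thesis by (simp add: dvd_eq_mod_eq_0)
  qed
  have "Polynomial.degree c > 0"
  proof (rule ccontr)
    assume "\<not> Polynomial.degree c > 0"
    then have "Polynomial.degree (ac_poly c) = 0" by simp
    then obtain e where "ac_poly c = [:e:]" using degree_eq_zeroE by blast
    then have "ac_poly c = 0" using c by simp
    then show False using c by simp
  qed
  then show ?thesis using that dvd assms by blast
qed

lemma common_zero_factor:
  assumes F: "homogeneous2 n F" "F \<noteq> 0" and G: "homogeneous2 m G" "G \<noteq> 0"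
    and "mult_at P F > 0" "mult_at P G > 0"
  obtains C k F' where "homogeneous2 k C" "0 < k" "k \<le> n" "k \<le> m" "F = C * F'" "C dvd G"
    "homogeneous2 (n - k) F'"
proof -
  define f g where "f = dehomogenize F" and "g = dehomogenize G"
  have nonzero: "f \<noteq> 0" "g \<noteq> 0" using assms dehomogenize_eq_0_iff by (auto simp: f_def g_def)
  have le: "Polynomial.degree f \<le> n" "Polynomial.degree g \<le> m"
    using degree_dehomogenize assms by (auto simp: f_def g_def)
  have "\<exists>c k f' g'. f = c * f' \<and> g = c * g' \<and> Polynomial.degree c \<le> k \<and> 0 < k \<and> k \<le> n \<and> k \<le> m
    \<and> Polynomial.degree f' \<le> n - k \<and> Polynomial.degree g' \<le> m - k"
  proof (cases P)
    case None
    then have "Polynomial.degree f < n" "Polynomial.degree g < m"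
      using assms by (auto simp: mult_at_None[OF F] mult_at_None[OF G] f_def g_def)
    \<comment> \<open>At [1 : 0] the common factor is y, which is \<open>homogenize 1 1\<close>: c =
      1 with k = 1.\<close>
    then show ?thesis by (intro exI[of _ 1] exI[of _ f] exI[of _ g]) auto
  next
    case (Some a)
    then have "poly (ac_poly f) a = 0" "poly (ac_poly g) a = 0"
      using assms(5,6) by (auto simp: mult_at_Some[OF F] mult_at_Some[OF G] f_def g_def order_root)
    then obtain c where c: "c dvd f" "c dvd g" "Polynomial.degree c > 0"
      using common_root_factor[OF nonzero(1)] by blast
    then obtain f' g' where fg: "f = c * f'" "g = c * g'" by (auto elim!: dvdE)
    with nonzero have "c \<noteq> 0" "f' \<noteq> 0" "g' \<noteq> 0" by auto
    then have "Polynomial.degree f = Polynomial.degree c + Polynomial.degree f'"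
      "Polynomial.degree g = Polynomial.degree c + Polynomial.degree g'"
      by (simp_all add: fg degree_mult_eq)
    with c(3) fg le show ?thesis
      by (intro exI[of _ c] exI[of _ "Polynomial.degree c"] exI[of _ f'] exI[of _ g']) auto
  qed
  then obtain c k f' g' where *: "f = c * f'" "g = c * g'" "Polynomial.degree c \<le> k" "0 < k" "k \<le> n" "k \<le> m"
    "Polynomial.degree f' \<le> n - k" "Polynomial.degree g' \<le> m - k" by blast
  have "F = homogenize k c * homogenize (n - k) f'"
    using homogenize_dehomogenize[OF F(1)] * by (simp add: f_def[symmetric] flip: homogenize_mult)
  moreover have "G = homogenize k c * homogenize (m - k) g'"
    using homogenize_dehomogenize[OF G(1)] * by (simp add: g_def[symmetric] flip: homogenize_mult)
  ultimately show ?thesis using that * homogeneous2_homogenize by (metis dvd_triv_left)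
qed

subsection \<open>Rational maps as power series maps\<close>

lemma same_refl: "same_map T T"
  unfolding same_map_def by (metis fps_one_nth smul_1 zero_neq_one)

lemma same_trans: "same_map T T' \<Longrightarrow> same_map T' T'' \<Longrightarrow> same_map T T''"
  unfolding same_map_def
proof (intro allI impI)
  fix V :: "'a fvec"
  assume 1: "\<forall>V. nonvanishing V \<longrightarrow> (\<exists>c. fps_nth c 0 \<noteq> 0 \<and> T V = smul c (T' V))"
    and 2: "\<forall>V. nonvanishing V \<longrightarrow> (\<exists>c. fps_nth c 0 \<noteq> 0 \<and> T' V = smul c (T'' V))" and V: "nonvanishing V"
  from 1 2 V obtain c c' where "fps_nth c 0 \<noteq> 0" "T V = smul c (T' V)"
    "fps_nth c' 0 \<noteq> 0" "T' V = smul c' (T'' V)" by meson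
  then show "\<exists>c. fps_nth c 0 \<noteq> 0 \<and> T V = smul c (T'' V)"
    by (intro exI[of _ "c * c'"]) (simp add: smul_smul)
qed

lemma same_sym: "same_map T T' \<Longrightarrow> same_map T' T"
  unfolding same_map_def
proof (intro allI impI)
  fix V :: "'a fvec"
  assume 1: "\<forall>V. nonvanishing V \<longrightarrow> (\<exists>c. fps_nth c 0 \<noteq> 0 \<and> T V = smul c (T' V))" and V: "nonvanishing V"
  from 1 V obtain c where c: "fps_nth c 0 \<noteq> 0" "T V = smul c (T' V)" by meson
  then have "T' V = smul (inverse c) (T V)"
    using inverse_mult_eq_1[OF c(1)] by (simp add: smul_smul)
  then show "\<exists>c. fps_nth c 0 \<noteq> 0 \<and> T' V = smul c (T V)"
    using c by (intro exI[of _ "inverse c"]) simp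
qed

lemma same_comp_left:
  assumes "homog_map D S" "same_map T T'"
  shows "same_map (\<lambda>V. S (T V)) (\<lambda>V. S (T' V))"
  unfolding same_map_def
proof (intro allI impI)
  fix V :: "'a fvec" assume "nonvanishing V"
  then obtain c where "fps_nth c 0 \<noteq> 0" "T V = smul c (T' V)"
    using assms(2) unfolding same_map_def by blast
  then show "\<exists>c. fps_nth c 0 \<noteq> 0 \<and> S (T V) = smul c (S (T' V))"
    by (intro exI[of _ "c ^ D"]) (simp add: homog_map_smul[OF assms(1)] fps_nth_power_0)
qed

lemma same_comp_right:
  assumes "homog_map D S" "same_map T T'"
  shows "same_map (\<lambda>V. T (S V)) (\<lambda>V. T' (S V))"
  using assms(2) homog_map_nonvanishing[OF assms(1)] unfolding same_map_def by blast

lemma same_commute_funpow: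
  assumes "homog_map D S" "homog_map D' T" "same_map (\<lambda>V. S (T V)) (\<lambda>V. T (S V))"
  shows "same_map (\<lambda>V. S ((T ^^ k) V)) (\<lambda>V. (T ^^ k) (S V))"
proof (induction k)
  case 0
  show ?case by (simp add: same_refl)
next
  case (Suc k)
  have "same_map (\<lambda>V. S (T ((T ^^ k) V))) (\<lambda>V. T (S ((T ^^ k) V)))"
    by (rule same_comp_right[OF homog_map_funpow[OF assms(2)] assms(3)])
  moreover have "same_map (\<lambda>V. T (S ((T ^^ k) V))) (\<lambda>V. T ((T ^^ k) (S V)))"
    by (rule same_comp_left[OF assms(2) Suc])
  ultimately show ?case using same_trans by fastforce
qed

definition map_of_ratmap :: "'k::field ratmap \<Rightarrow> 'k alg_closure fvec \<Rightarrow> 'k alg_closure fvec" where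
  "map_of_ratmap \<psi> V = (eval_fps (fst \<psi>) V, eval_fps (snd \<psi>) V)"

lemma map_of_ratmap_comp: "map_of_ratmap (ratmap_comp \<psi> \<phi>) V = map_of_ratmap \<psi> (map_of_ratmap \<phi> V)"
  by (simp add: map_of_ratmap_def ratmap_comp_def eval_fps_def eval2_subst2[OF ring_morphism_ac])

lemma map_of_ratmap_iter: "map_of_ratmap (ratmap_iter \<phi> n) = map_of_ratmap \<phi> ^^ n"
proof (induction n)
  case 0
  show ?case
    by (rule ext) (simp add: map_of_ratmap_def eval_fps_def eval2_varx[OF ring_morphism_ac] eval2_vary[OF ring_morphism_ac])
next
  case (Suc n)
  show ?case
    by (rule ext) (simp add: map_of_ratmap_comp Suc funpow_swap1)
qed

text \<open>Coprimality of iterates is never established. Only the degree is tracked here, and the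
  absence of common zeros is carried by \<open>homog_map\<close>.\<close>

definition hpair :: "nat \<Rightarrow> 'k::field ratmap \<Rightarrow> bool" where
  "hpair n \<psi> \<longleftrightarrow> homogeneous2 n (fst \<psi>) \<and> homogeneous2 n (snd \<psi>)"

lemma homogeneous2_subst2:
  assumes "homogeneous2 n P" "homogeneous2 m A" "homogeneous2 m B"
  shows "homogeneous2 (n * m) (subst2 P A B)"
  unfolding subst2_eval2 eval2_homogeneous[OF ring_morphism_const2 assms(1)]
proof (rule homogeneous2_sum)
  fix i assume i: "i \<in> {..n}"
  have "homogeneous2 (0 + m * i + m * (n - i)) (const2 (poly.coeff (poly.coeff P (n - i)) i) * A ^ i * B ^ (n - i))"
    by (intro homogeneous2_mult homogeneous2_power assms homogeneous2_const2)
  moreover have "0 + m * i + m * (n - i) = n * m"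
    using i by (simp flip: distrib_left)
  ultimately show "homogeneous2 (n * m) (const2 (poly.coeff (poly.coeff P (n - i)) i) * A ^ i * B ^ (n - i))"
    by simp
qed

lemma hpair_comp: "hpair n \<psi> \<Longrightarrow> hpair m \<phi> \<Longrightarrow> hpair (n * m) (ratmap_comp \<psi> \<phi>)"
  by (simp add: hpair_def ratmap_comp_def homogeneous2_subst2)

lemma hpair_iter: "hpair m \<phi> \<Longrightarrow> hpair (m ^ n) (ratmap_iter \<phi> n)"
proof (induction n)
  case 0
  show ?case using homogeneous2_varx homogeneous2_vary by (simp add: hpair_def)
next
  case (Suc n)
  then show ?case using hpair_comp[of "m ^ n" "ratmap_iter \<phi> n" m \<phi>] by (simp add: mult.commute)
qed

definition fixpoly :: "'k::field ratmap \<Rightarrow> 'k bipoly" where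
  "fixpoly \<psi> = vary * fst \<psi> - varx * snd \<psi>"

lemma period_poly_fixpoly: "period_poly \<phi> n = fixpoly (ratmap_iter \<phi> n)"
  by (simp add: period_poly_def fixpoly_def)

lemma homogeneous2_fixpoly: "hpair n \<psi> \<Longrightarrow> homogeneous2 (n + 1) (fixpoly \<psi>)"
  unfolding fixpoly_def hpair_def
  by (metis homogeneous2_diff homogeneous2_mult homogeneous2_varx homogeneous2_vary add.commute)

lemma fix_det_map_of_ratmap: "fix_det P (map_of_ratmap \<psi>) = eval_fps (fixpoly \<psi>) (param P)"
proof -
  interpret E: ring_morphism "\<lambda>H. eval_fps H (param P)" by (rule ring_morphism_eval_fps)
  show ?thesis
    by (simp add: fix_det_def vdet_def map_of_ratmap_def fixpoly_def E.diff E.mult)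
      (simp add: eval_fps_def eval2_varx[OF ring_morphism_ac] eval2_vary[OF ring_morphism_ac])
qed

lemma homog_map_map_of_ratmap:
  assumes "hpair n \<psi>" "\<And>V. nonvanishing V \<Longrightarrow> nonvanishing (map_of_ratmap \<psi> V)"
  shows "homog_map n (map_of_ratmap \<psi>)"
  unfolding homog_map_def
proof (intro conjI allI impI)
  show "map_of_ratmap \<psi> (smul c V) = smul (c ^ n) (map_of_ratmap \<psi> V)" for c V
    using assms(1) by (simp add: map_of_ratmap_def hpair_def eval_fps_smul[of n] smul_def[of "c ^ n"])
  show "map_of_ratmap \<psi> (vcomp V \<beta>) = vcomp (map_of_ratmap \<psi> V) \<beta>" if "fps_nth \<beta> 0 = 0" for V \<beta>
    using that by (simp add: map_of_ratmap_def eval_fps_vcomp) (simp add: vcomp_def)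
qed (rule assms(2))

text \<open>A common zero of the two forms over the closure would yield a common factor of positive
  degree over K, against coprimality.\<close>

lemma homog_map_rational_map:
  assumes "rational_map d \<phi>" "d > 0"
  shows "homog_map d (map_of_ratmap \<phi>)"
proof (rule homog_map_map_of_ratmap)
  have h: "homogeneous2 d (fst \<phi>)" "homogeneous2 d (snd \<phi>)" and co: "coprime (fst \<phi>) (snd \<phi>)"
    using assms(1) by (auto simp: rational_map_def)
  then show "hpair d \<phi>" by (simp add: hpair_def)
  have nu: "\<not> fst \<phi> dvd 1" "\<not> snd \<phi> dvd 1" using homogeneous2_not_unit h assms(2) by blast+
  have n0: "fst \<phi> \<noteq> 0" "snd \<phi> \<noteq> 0" using co nu by auto
  fix V :: "'a alg_closure fvec" assume V: "nonvanishing V"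
  show "nonvanishing (map_of_ratmap \<phi> V)"
  proof (rule ccontr)
    assume "\<not> nonvanishing (map_of_ratmap \<phi> V)"
    then have "fps_nth (eval_fps (fst \<phi>) (param (point_of V))) 0 = 0" "fps_nth (eval_fps (snd \<phi>) (param (point_of V))) 0 = 0"
      using eval_fps_nth_0_point_of[OF h(1) V] eval_fps_nth_0_point_of[OF h(2) V] by (auto simp: nonvanishing_def map_of_ratmap_def)
    then have "1 \<le> mult_at (point_of V) (fst \<phi>)" "1 \<le> mult_at (point_of V) (snd \<phi>)"
      by (simp_all add: le_mult_at_iff[OF h(1) n0(1)] le_mult_at_iff[OF h(2) n0(2)])
    then obtain C k F' where C: "homogeneous2 k C" "0 < k" "fst \<phi> = C * F'" "C dvd snd \<phi>"
      using common_zero_factor[OF h(1) n0(1) h(2) n0(2)] by (metis less_eq_Suc_le One_nat_def)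
    then have "C dvd fst \<phi>" by simp
    with C co have "C dvd 1" using coprime_common_divisor by blast
    then show False using homogeneous2_not_unit C by blast
  qed
qed

text \<open>If yF = xG then F = xH and G = yH with H of degree n - 1 > 0, and a zero of H is a
  common zero. The identity shows why n = 1 is excluded.\<close>

lemma fixpoly_nonzero:
  fixes \<psi> :: "'k::field ratmap"
  assumes h: "hpair n \<psi>" and "n \<ge> 2" and g: "homog_map n (map_of_ratmap \<psi>)"
  shows "fixpoly \<psi> \<noteq> 0"
proof
  assume z: "fixpoly \<psi> = 0"
  define f g where "f = dehomogenize (fst \<psi>)" and "g = dehomogenize (snd \<psi>)"
  interpret D: ring_morphism "dehomogenize :: 'k bipoly \<Rightarrow> _" by (rule ring_morphism_dehomogenize)
  have hf: "homogeneous2 n (fst \<psi>)" and hg: "homogeneous2 n (snd \<psi>)" using h by (auto simp: hpair_def)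
  have "dehomogenize vary = (1 :: 'k poly)" "dehomogenize varx = ([:0, 1:] :: 'k poly)"
    by (simp_all add: dehomogenize_def eval2_varx eval2_vary ring_morphism_const)
  then have fg: "f = [:0, 1:] * g"
    using arg_cong[OF z, of dehomogenize] by (simp add: fixpoly_def D.diff D.mult D.zero f_def g_def)
  have "\<exists>P. fps_nth (eval_fps (fst \<psi>) (param P)) 0 = 0 \<and> fps_nth (eval_fps (snd \<psi>) (param P)) 0 = 0"
  proof (cases "Polynomial.degree g = 0")
    case True
    then have "Polynomial.degree f \<le> 1"
      using degree_mult_le[of "[:0, 1:]" g] by (simp add: fg del: mult_pCons_left)
    \<comment> \<open>Both polynomials have degree below n, so both forms vanish at [1 : 0].\<close>
    then have "poly.coeff f n = 0" "poly.coeff g n = 0" using assms(2) True by (auto intro!: coeff_eq_0)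
    then show ?thesis
      by (intro exI[of _ None]) (simp add: eval_fps_None_nth[OF hf] eval_fps_None_nth[OF hg] f_def g_def)
  next
    case False
    then obtain a where a: "poly (ac_poly g) a = 0"
      using alg_closed_imp_poly_has_root[of "ac_poly g"] by auto
    then have "poly (ac_poly f) a = 0" by (simp add: fg ring_morphism.mult[OF ring_morphism_ac_poly] del: mult_pCons_left)
    with a show ?thesis
      by (intro exI[of _ "Some a"]) (simp add: eval_fps_Some peval_fps_const_nth_0 f_def g_def)
  qed
  then show False using homog_map_nonvanishing[OF g nonvanishing_param] by (auto simp: nonvanishing_def map_of_ratmap_def)
qed

section \<open>Matrices acting on arcs\<close>

lemma map_of_ratmap_matrix:
  "map_of_ratmap (ratmap_of_matrix A) V =
    (fps_const (to_ac (vec_nth (vec_nth A 1) 1)) * fst V + fps_const (to_ac (vec_nth (vec_nth A 1) 2)) * snd V,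
     fps_const (to_ac (vec_nth (vec_nth A 2) 1)) * fst V + fps_const (to_ac (vec_nth (vec_nth A 2) 2)) * snd V)"
proof -
  interpret E: ring_morphism "\<lambda>H. eval_fps H V" by (rule ring_morphism_eval_fps)
  show ?thesis
    by (simp add: map_of_ratmap_def ratmap_of_matrix_def E.add E.mult)
      (simp add: eval_fps_def eval2_varx[OF ring_morphism_ac] eval2_vary[OF ring_morphism_ac] eval2_const2[OF ring_morphism_ac])
qed

lemma map_of_ratmap_matrix_mult:
  "map_of_ratmap (ratmap_of_matrix A) (map_of_ratmap (ratmap_of_matrix B) V) = map_of_ratmap (ratmap_of_matrix (A ** B)) V"
  by (simp add: map_of_ratmap_matrix matrix_matrix_mult_def sum_2 algebra_simps flip: fps_const_add fps_const_mult)

lemma map_of_ratmap_mat: "map_of_ratmap (ratmap_of_matrix (mat c)) V = smul (fps_const (to_ac c)) V"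
  by (simp add: map_of_ratmap_matrix mat_def smul_def)

lemma matrix_inv_inverse:
  assumes "invertible A"
  shows "A ** matrix_inv A = mat 1" "matrix_inv A ** A = mat 1"
  using someI_ex[of "\<lambda>A'. A ** A' = mat 1 \<and> A' ** A = mat 1"] assms
  by (auto simp: invertible_def matrix_inv_def)

lemma map_of_ratmap_matrix_inv:
  assumes "invertible A"
  shows "map_of_ratmap (ratmap_of_matrix A) (map_of_ratmap (ratmap_of_matrix (matrix_inv A)) V) = V"
    and "map_of_ratmap (ratmap_of_matrix (matrix_inv A)) (map_of_ratmap (ratmap_of_matrix A) V) = V"
  by (simp_all add: map_of_ratmap_matrix_mult matrix_inv_inverse(1)[OF assms] matrix_inv_inverse(2)[OF assms] map_of_ratmap_mat)

lemma hpair_matrix: "hpair 1 (ratmap_of_matrix A)"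
proof -
  have "homogeneous2 1 (const2 a * varx + const2 b * vary)" for a b :: 'a
    using homogeneous2_add[OF homogeneous2_mult[OF homogeneous2_const2 homogeneous2_varx]
        homogeneous2_mult[OF homogeneous2_const2 homogeneous2_vary]] by simp
  then show ?thesis by (simp add: hpair_def ratmap_of_matrix_def)
qed

lemma homog_map_matrix:
  assumes "invertible A"
  shows "homog_map 1 (map_of_ratmap (ratmap_of_matrix A))"
proof (rule homog_map_map_of_ratmap[OF hpair_matrix])
  fix V :: "'a alg_closure fvec" assume V: "nonvanishing V"
  show "nonvanishing (map_of_ratmap (ratmap_of_matrix A) V)"
  proof (rule ccontr)
    assume "\<not> nonvanishing (map_of_ratmap (ratmap_of_matrix A) V)"
    then have "\<not> nonvanishing (map_of_ratmap (ratmap_of_matrix (matrix_inv A)) (map_of_ratmap (ratmap_of_matrix A) V))"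
      by (simp add: nonvanishing_def map_of_ratmap_matrix[of "matrix_inv A"])
    then show False using V by (simp add: map_of_ratmap_matrix_inv[OF assms])
  qed
qed

lemma invertible_matrix_inv: "invertible A \<Longrightarrow> invertible (matrix_inv A)"
  using matrix_inv_inverse unfolding invertible_def by metis

text \<open>Some coordinate of \<open>U\<close> is a unit; the quotient by it gives c, and c is a
  unit because \<open>W\<close> does not vanish at X = 0.\<close>

lemma proportional_fvec:
  assumes "nonvanishing W" "nonvanishing U" "fst W * snd U = snd W * fst U"
  shows "\<exists>c. fps_nth c 0 \<noteq> 0 \<and> W = smul c U"
proof -
  have *: "\<exists>c. w = c * u \<and> w' = c * u'"
    if "fps_nth u 0 \<noteq> 0" "w * u' = w' * u" for w w' u u' :: "'a fps"
  proof (intro exI conjI)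
    have i: "u * inverse u = 1" by (rule inverse_mult_eq_1'[OF that(1)])
    have "(w * inverse u) * u = w * (u * inverse u)" by (simp only: ac_simps)
    then show "w = (w * inverse u) * u" unfolding i by simp
    have "(w * inverse u) * u' = (w * u') * inverse u" by (simp only: ac_simps)
    also have "\<dots> = w' * (u * inverse u)" unfolding that(2) by (simp only: ac_simps)
    finally show "w' = (w * inverse u) * u'" unfolding i by simp
  qed
  have "\<exists>c. fst W = c * fst U \<and> snd W = c * snd U"
    using *[of "fst U" "fst W" "snd U" "snd W"] *[of "snd U" "snd W" "fst U" "fst W"] assms(2,3)
    by (auto simp: nonvanishing_def)
  then obtain c where c: "W = smul c U" by (auto simp: smul_def prod_eq_iff)
  then have "fps_nth c 0 \<noteq> 0" using assms(1) by (auto simp: nonvanishing_def smul_def)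
  with c show ?thesis by blast
qed

text \<open>Evaluating the cross-multiplied identity for \<open>h^-1 \<phi> h = \<phi>\<close> on an
  arc gives proportionality by a unit; applying h clears the inverse.\<close>

lemma automorphism_commute:
  assumes "homog_map d (map_of_ratmap \<phi>)" "invertible A" "is_automorphism A \<phi>"
  shows "same_map (\<lambda>V. map_of_ratmap \<phi> (map_of_ratmap (ratmap_of_matrix A) V)) (\<lambda>V. map_of_ratmap (ratmap_of_matrix A) (map_of_ratmap \<phi> V))"
  unfolding same_map_def
proof (intro allI impI)
  fix V :: "'a alg_closure fvec" assume V: "nonvanishing V"
  let ?g = "map_of_ratmap (ratmap_of_matrix A)" and ?i = "map_of_ratmap (ratmap_of_matrix (matrix_inv A))"
  let ?psi = "ratmap_comp (ratmap_of_matrix (matrix_inv A)) (ratmap_comp \<phi> (ratmap_of_matrix A))"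
  have g: "homog_map 1 ?g" "homog_map 1 ?i" by (intro homog_map_matrix assms invertible_matrix_inv)+
  have E: "map_of_ratmap ?psi V = ?i (map_of_ratmap \<phi> (?g V))" by (simp add: map_of_ratmap_comp)
  have "nonvanishing (map_of_ratmap ?psi V)" "nonvanishing (map_of_ratmap \<phi> V)"
    unfolding E using V by (intro homog_map_nonvanishing[OF assms(1)] homog_map_nonvanishing[OF g(1)] homog_map_nonvanishing[OF g(2)], assumption)+
  moreover have "fst (map_of_ratmap ?psi V) * snd (map_of_ratmap \<phi> V) = snd (map_of_ratmap ?psi V) * fst (map_of_ratmap \<phi> V)"
    using assms(3) unfolding is_automorphism_def ratmap_eq_def
    by (simp add: map_of_ratmap_def flip: ring_morphism.mult[OF ring_morphism_eval_fps])
  ultimately obtain c where c: "fps_nth c 0 \<noteq> 0" "map_of_ratmap ?psi V = smul c (map_of_ratmap \<phi> V)"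
    using proportional_fvec by blast
  have "map_of_ratmap \<phi> (?g V) = ?g (smul c (map_of_ratmap \<phi> V))"
    using c(2) E map_of_ratmap_matrix_inv(1)[OF assms(2)] by metis
  also have "\<dots> = smul c (?g (map_of_ratmap \<phi> V))" using homog_map_smul[OF g(1)] by simp
  finally show "\<exists>c. fps_nth c 0 \<noteq> 0 \<and> map_of_ratmap \<phi> (?g V) = smul c (?g (map_of_ratmap \<phi> V))" using c(1) by blast
qed

lemma fixpoly_matrix_nonzero:
  fixes A :: "'k::field ^ 2 ^ 2"
  assumes "invertible A" "A \<notin> scalars2"
  shows "fixpoly (ratmap_of_matrix A) \<noteq> 0"
proof
  assume z: "fixpoly (ratmap_of_matrix A) = 0"
  interpret D: ring_morphism "dehomogenize :: 'k bipoly \<Rightarrow> _" by (rule ring_morphism_dehomogenize)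
  have "dehomogenize vary = (1 :: 'k poly)" "dehomogenize varx = ([:0, 1:] :: 'k poly)" "dehomogenize (const2 a) = [:a:]" for a :: 'k
    by (simp_all add: dehomogenize_def eval2_varx eval2_vary eval2_const2 ring_morphism_const)
  \<comment> \<open>The fixed point form of a matrix has coefficients a12, a11 - a22 and -a21; all
    vanish only for scalar matrices.\<close>
  then have "[:vec_nth (vec_nth A 1) 2, vec_nth (vec_nth A 1) 1 - vec_nth (vec_nth A 2) 2, - vec_nth (vec_nth A 2) 1:] = 0"
    using arg_cong[OF z, of dehomogenize]
    by (simp add: fixpoly_def ratmap_of_matrix_def D.diff D.mult D.add D.zero algebra_simps)
  then have e: "vec_nth (vec_nth A 1) 2 = 0" "vec_nth (vec_nth A 2) 1 = 0" "vec_nth (vec_nth A 1) 1 = vec_nth (vec_nth A 2) 2"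
    by auto
  then have A: "A = mat (vec_nth (vec_nth A 1) 1)"
    by (simp add: vec_eq_iff mat_def forall_2)
  have "vec_nth (vec_nth A 1) 1 \<noteq> 0"
  proof
    assume "vec_nth (vec_nth A 1) 1 = 0"
    then have "A = 0" using A by (simp add: vec_eq_iff mat_def)
    then have "mat 1 = (0 :: 'k ^ 2 ^ 2)" using matrix_inv_inverse(1)[OF assms(1)]
      by (simp add: vec_eq_iff matrix_matrix_mult_def)
    then have "vec_nth (vec_nth (mat 1 :: 'k ^ 2 ^ 2) 1) 1 = 0" by simp
    then show False by (simp add: mat_def)
  qed
  with A assms(2) show False unfolding scalars2_def by blast
qed

section \<open>The order of \<open>h\<close> in the projective linear group\<close>

lemma group_GL2: "group (GL2 :: ('k::field ^ 2 ^ 2) monoid)"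
proof (rule groupI)
  show "\<And>x y. x \<in> carrier GL2 \<Longrightarrow> y \<in> carrier GL2 \<Longrightarrow> x \<otimes>\<^bsub>GL2\<^esub> y \<in> carrier (GL2 :: ('k ^ 2 ^ 2) monoid)"
    by (simp add: GL2_def invertible_mult)
  show "\<one>\<^bsub>GL2\<^esub> \<in> carrier (GL2 :: ('k ^ 2 ^ 2) monoid)"
    by (auto simp: GL2_def invertible_def intro!: exI[of _ "mat 1"])
  show "\<And>x y z. x \<otimes>\<^bsub>GL2\<^esub> y \<otimes>\<^bsub>GL2\<^esub> z = x \<otimes>\<^bsub>GL2\<^esub> (y \<otimes>\<^bsub>GL2\<^esub> (z :: 'k ^ 2 ^ 2))"
    by (simp add: GL2_def matrix_mul_assoc)
  show "\<And>x. \<one>\<^bsub>GL2\<^esub> \<otimes>\<^bsub>GL2\<^esub> x = (x :: 'k ^ 2 ^ 2)"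
    by (simp add: GL2_def)
  show "\<And>x. x \<in> carrier (GL2 :: ('k ^ 2 ^ 2) monoid) \<Longrightarrow> \<exists>y\<in>carrier GL2. y \<otimes>\<^bsub>GL2\<^esub> x = \<one>\<^bsub>GL2\<^esub>"
    using invertible_matrix_inv matrix_inv_inverse(2) by (auto simp: GL2_def)
qed

lemma mat_mult_commute:
  fixes c :: "'k::field" and A :: "'k ^ 2 ^ 2"
  shows "mat c ** A = A ** mat c"
  by (simp add: vec_eq_iff matrix_matrix_mult_def mat_def forall_2 sum_2)

lemma mat_mult_mat: "mat c ** mat e = (mat (c * e) :: 'k::field ^ 2 ^ 2)"
  by (simp add: vec_eq_iff matrix_matrix_mult_def mat_def forall_2 sum_2)

lemma scalars2_normal: "scalars2 \<lhd> (GL2 :: ('k::field ^ 2 ^ 2) monoid)"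
proof -
  interpret G: group "GL2 :: ('k ^ 2 ^ 2) monoid" by (rule group_GL2)
  have inv: "mat c \<in> carrier (GL2 :: ('k ^ 2 ^ 2) monoid)" if "c \<noteq> 0" for c :: 'k
    using that by (auto simp: GL2_def invertible_def mat_mult_mat intro!: exI[of _ "mat (inverse c)"])
  have sub: "subgroup scalars2 (GL2 :: ('k ^ 2 ^ 2) monoid)"
  proof (rule G.subgroupI)
    show "scalars2 \<subseteq> carrier (GL2 :: ('k ^ 2 ^ 2) monoid)" using inv by (auto simp: scalars2_def)
    show "scalars2 \<noteq> ({} :: ('k ^ 2 ^ 2) set)" by (auto simp: scalars2_def intro!: exI[of _ 1])
    show "inv\<^bsub>GL2\<^esub> a \<in> scalars2" if "a \<in> scalars2" for a :: "'k ^ 2 ^ 2"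
    proof -
      from that obtain c where c: "a = mat c" "c \<noteq> 0" by (auto simp: scalars2_def)
      have "inv\<^bsub>GL2\<^esub> a = mat (inverse c)"
        using c inv[of c] inv[of "inverse c"] by (intro G.inv_equality) (auto simp: GL2_def mat_mult_mat)
      then show ?thesis using c by (auto simp: scalars2_def)
    qed
    show "a \<otimes>\<^bsub>GL2\<^esub> b \<in> scalars2" if "a \<in> scalars2" "b \<in> scalars2" for a b :: "'k ^ 2 ^ 2"
      using that by (force simp: scalars2_def GL2_def mat_mult_mat)
  qed
  show ?thesis
  proof (rule G.normalI[OF sub], rule ballI)
    fix x :: "'k ^ 2 ^ 2"
    show "scalars2 #>\<^bsub>GL2\<^esub> x = x <#\<^bsub>GL2\<^esub> scalars2"
      by (auto simp: r_coset_def l_coset_def scalars2_def GL2_def) (metis mat_mult_commute)+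
  qed
qed

text \<open>The kernel of \<open>pgl_class\<close> is \<open>scalars2\<close>, so order p becomes a
  statement on matrices. Nonscalar makes the fixed points of h finite in number; the scalar power
  makes exponents of h matter only modulo p.\<close>

lemma pgl_order:
  fixes h :: "'k::field ^ 2 ^ 2"
  assumes "h \<in> carrier GL2" "group.ord PGL2 (pgl_class h) = p" "Factorial_Ring.prime p"
  shows "h \<notin> scalars2" "h [^]\<^bsub>GL2\<^esub> p \<in> scalars2"
proof -
  interpret N: normal scalars2 "GL2 :: ('k ^ 2 ^ 2) monoid" by (rule scalars2_normal)
  interpret Q: group "PGL2 :: ('k ^ 2 ^ 2) set monoid"
    unfolding PGL2_def by (rule N.factorgroup_is_group)
  have hom: "group_hom GL2 (PGL2 :: ('k ^ 2 ^ 2) set monoid) pgl_class"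
    using N.r_coset_hom_Mod group_GL2 Q.group_axioms
    by (simp add: group_hom_def group_hom_axioms_def PGL2_def pgl_class_def[abs_def])
  interpret H: group_hom GL2 "PGL2 :: ('k ^ 2 ^ 2) set monoid" pgl_class by (rule hom)
  have one: "\<one>\<^bsub>PGL2\<^esub> = (scalars2 :: ('k ^ 2 ^ 2) set)" by (simp add: PGL2_def FactGroup_def)
  have hc: "pgl_class h \<in> carrier PGL2" using assms(1) by simp
  have "pgl_class (h [^]\<^bsub>GL2\<^esub> p) = pgl_class h [^]\<^bsub>PGL2\<^esub> p" using assms(1) by (rule H.hom_nat_pow)
  also have "\<dots> = \<one>\<^bsub>PGL2\<^esub>" using Q.pow_ord_eq_1[OF hc] assms(2) by simp
  finally have "pgl_class (h [^]\<^bsub>GL2\<^esub> p) = scalars2" using one by simp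
  moreover have "h [^]\<^bsub>GL2\<^esub> p \<in> pgl_class (h [^]\<^bsub>GL2\<^esub> p)"
    unfolding pgl_class_def using assms(1) N.subgroup_axioms by (intro N.rcos_self) auto
  ultimately show "h [^]\<^bsub>GL2\<^esub> p \<in> scalars2" by simp
  show "h \<notin> scalars2"
  proof
    assume "h \<in> scalars2"
    then have "pgl_class h = \<one>\<^bsub>PGL2\<^esub>"
      unfolding pgl_class_def one using assms(1) N.subgroup_axioms by (intro N.coset_join2) auto
    then have "group.ord PGL2 (pgl_class h) = 1" using Q.ord_eq_1[OF hc] by simp
    then show False using assms(2,3) by simp
  qed
qed

lemma map_of_ratmap_matrix_pow: "map_of_ratmap (ratmap_of_matrix (h [^]\<^bsub>GL2\<^esub> n)) = map_of_ratmap (ratmap_of_matrix h) ^^ n"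
proof (induction n)
  case 0
  show ?case by (rule ext) (simp add: GL2_def map_of_ratmap_mat)
next
  case (Suc n)
  have "h [^]\<^bsub>GL2\<^esub> Suc n = (h [^]\<^bsub>GL2\<^esub> n) ** h" by (simp add: GL2_def)
  then show ?case
    by (intro ext) (simp add: map_of_ratmap_matrix_mult[symmetric] Suc funpow_swap1)
qed

subsection \<open>Moebius sums of fixed point multiplicities\<close>

text \<open>For a prime q dividing n, k |-> qk matches the squarefree divisors prime to q with those
  divisible by q and flips the sign.\<close>

lemma sum_moebius_mu:
  assumes "n > 0"
  shows "(\<Sum>k | k dvd n. moebius_mu k) = (if n = 1 then 1 else 0)"
proof (cases "n = 1")
  case True
  then show ?thesis by (simp add: moebius_mu_def)
next
  case False
  then obtain q where q: "Factorial_Ring.prime q" "q dvd n" using prime_factor_nat by blast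
  let ?A = "{k. k dvd n \<and> squarefree k \<and> \<not> q dvd k}" and ?B = "{k. k dvd n \<and> squarefree k \<and> q dvd k}"
  have fin: "finite {k. k dvd n}" using assms by simp
  have coq: "coprime q k" if "k \<in> ?A" for k
    using that q by (simp add: prime_imp_coprime)
  have sf: "squarefree (q * k)" if "k \<in> ?A" for k
    using that coq[OF that] q by (simp add: squarefree_mult_coprime squarefree_prime)
  have bij: "bij_betw ((*) q) ?A ?B"
  proof (rule bij_betw_imageI)
    show "inj_on ((*) q) ?A" using q(1) by (auto simp: inj_on_def prime_gt_0_nat)
    show "(*) q ` ?A = ?B"
    proof (intro equalityI subsetI)
      fix x assume "x \<in> (*) q ` ?A"
      then obtain k where k: "k \<in> ?A" "x = q * k" by auto
      then show "x \<in> ?B" using sf[OF k(1)] divides_mult[OF q(2) _ coq[OF k(1)]] by simp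
    next
      fix x assume x: "x \<in> ?B"
      then obtain k where k: "x = q * k" by (auto elim: dvdE)
      have "\<not> q dvd k"
      proof
        assume "q dvd k"
        then have "q ^ 2 dvd x" using k by (simp add: power2_eq_square)
        then have "is_unit q" using x unfolding squarefree_def by blast
        then show False using q(1) by auto
      qed
      moreover have "squarefree k" "k dvd n" using x k squarefree_mono[of k x] dvd_trans[of k x n] by auto
      ultimately show "x \<in> (*) q ` ?A" using k by auto
    qed
  qed
  have mu: "moebius_mu (q * k) = - moebius_mu k" if "k \<in> ?A" for k
  proof -
    have "k \<noteq> 0" using that assms by (auto intro: Nat.gr0I)
    then have "prime_factors (q * k) = insert q (prime_factors k)"
      using q(1) by (simp add: prime_factors_product prime_prime_factors prime_gt_0_nat)
    moreover have "q \<notin> prime_factors k" using that by auto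
    ultimately show ?thesis using sf[OF that] that by (simp add: moebius_mu_def)
  qed
  have "(\<Sum>k | k dvd n. moebius_mu k) = (\<Sum>k\<in>?A \<union> ?B. moebius_mu k)"
    using fin by (intro sum.mono_neutral_right) (auto simp: moebius_mu_def)
  also have "\<dots> = (\<Sum>k\<in>?A. moebius_mu k) + (\<Sum>k\<in>?B. moebius_mu k)"
    by (intro sum.union_disjoint finite_subset[OF _ fin]) auto
  also have "(\<Sum>k\<in>?B. moebius_mu k) = (\<Sum>k\<in>?A. moebius_mu (q * k))"
    using sum.reindex_bij_betw[OF bij, of moebius_mu] by simp
  also have "\<dots> = - (\<Sum>k\<in>?A. moebius_mu k)"
    using mu by (simp add: sum_negf)
  finally show ?thesis using False by simp
qed

lemma sum_moebius_mu_multiples: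
  assumes "n > 0" "r > 0"
  shows "(\<Sum>k | k dvd n. moebius_mu (n div k) * (if r dvd k then 1 else 0)) = (if n = r then 1 else 0)"
proof (cases "r dvd n")
  case False
  then have "(\<Sum>k | k dvd n. moebius_mu (n div k) * (if r dvd k then 1 else 0)) = 0"
    by (intro sum.neutral) (auto dest: dvd_trans)
  then show ?thesis using False by auto
next
  case True
  then obtain m where m: "n = r * m" by (auto elim: dvdE)
  with assms have m0: "m > 0" by simp
  have fin: "finite {k. k dvd n}" using assms by simp
  \<comment> \<open>Complementary divisors of m are used, so that the index \<open>n div k\<close>
    becomes a plain divisor of m.\<close>
  have bij: "bij_betw (\<lambda>k. r * (m div k)) {k. k dvd m} {k. k dvd n \<and> r dvd k}"
    using assms m0 by (intro bij_betw_byWitness[where f' = "\<lambda>k. m div (k div r)"])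
      (auto simp: m elim!: dvdE)
  have "(\<Sum>k | k dvd n. moebius_mu (n div k) * (if r dvd k then 1 else 0)) =
      (\<Sum>k | k dvd n \<and> r dvd k. moebius_mu (n div k))"
    using fin by (intro sum.mono_neutral_cong_right) auto
  also have "\<dots> = (\<Sum>k | k dvd m. moebius_mu (n div (r * (m div k))))"
    using sum.reindex_bij_betw[OF bij, of "\<lambda>k. moebius_mu (n div k)"] by simp
  also have "\<dots> = (\<Sum>k | k dvd m. moebius_mu k)"
    using assms m0 by (intro sum.cong) (auto simp: m elim!: dvdE)
  also have "\<dots> = (if n = r then 1 else 0)"
    using sum_moebius_mu[OF m0] assms by (auto simp: m)
  finally show ?thesis .
qed

text \<open>Euclid's argument for subgroups of the integers, with the least positive member as
  generator.\<close>

lemma subtractive_set_multiples: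
  fixes S :: "nat \<Rightarrow> bool"
  assumes S: "\<And>m n. 0 < m \<Longrightarrow> 0 < n \<Longrightarrow> S n \<Longrightarrow> S (m + n) \<longleftrightarrow> S m" and "0 < n0" "S n0"
  obtains r where "0 < r" "\<And>n. 0 < n \<Longrightarrow> S n \<longleftrightarrow> r dvd n"
proof -
  define r where "r = (LEAST n. 0 < n \<and> S n)"
  have r: "0 < r" "S r" using LeastI[of "\<lambda>n. 0 < n \<and> S n" n0] assms by (auto simp: r_def)
  have min: "r \<le> n" if "0 < n" "S n" for n
    unfolding r_def using that by (intro Least_le) simp
  have "S n \<longleftrightarrow> r dvd n" if "0 < n" for n
    using that
  proof (induction n rule: less_induct)
    case (less n)
    show ?case
    proof (cases "n > r")
      case True
      then have "S n \<longleftrightarrow> S (n - r)" using S[of "n - r" r] r by simp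
      also have "\<dots> \<longleftrightarrow> r dvd n - r" using less.IH[of "n - r"] True r by simp
      also have "\<dots> \<longleftrightarrow> r dvd n" using True by (simp add: dvd_minus_self)
      finally show ?thesis .
    next
      case False
      then show ?thesis using min[of n] r less.prems by (metis dvd_imp_le dvd_refl le_antisym not_le)
    qed
  qed
  then show ?thesis using that r by blast
qed

text \<open>Applied to multiplicities of a point in the period polynomials it gives the multiplicity
  in the dynatomic polynomial; applied to d^k + 1 it gives the degree.\<close>

definition moebius_transform :: "(nat \<Rightarrow> nat) \<Rightarrow> nat \<Rightarrow> int" where
  "moebius_transform E n = (\<Sum>k | k dvd n. moebius_mu (n div k) * int (E k))"

text \<open>
  Here \<open>E n\<close> is the multiplicity of a point in \<open>\<Phi>\<^sub>n\<close>, \<open>n0\<close> is the period of the point and \<open>r0 / n0\<close> the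
  order of its multiplier.
\<close>

lemma fixed_multiplicity_shape:
  fixes E :: "nat \<Rightarrow> nat"
  assumes S: "\<And>j m n. j \<in> {1, 2} \<Longrightarrow> 0 < m \<Longrightarrow> 0 < n \<Longrightarrow> j \<le> E n \<Longrightarrow> j \<le> E (m + n) \<longleftrightarrow> j \<le> E m"
    and C: "\<And>n k. 0 < n \<Longrightarrow> 0 < k \<Longrightarrow> 2 \<le> E n \<Longrightarrow> E (k * n) = E n"
  shows "\<exists>b c n0 r0. 0 < n0 \<and> 0 < r0 \<and> n0 dvd r0 \<and>
    (\<forall>n>0. E n = b * (if n0 dvd n then 1 else 0) + c * (if r0 dvd n then 1 else 0))"
proof (cases "\<exists>n>0. 1 \<le> E n")
  case False
  then have "E n = 0 * (if 1 dvd n then 1 else 0) + 0 * (if 1 dvd n then 1 else 0)" if "0 < n" for n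
  proof -
    have "\<not> 1 \<le> E n" using False that by blast
    then show ?thesis by simp
  qed
  then show ?thesis by (metis dvd_refl zero_less_one)
next
  case True
  then obtain n1 where "0 < n1" "1 \<le> E n1" by blast
  then obtain n0 where n0: "0 < n0" "\<And>n. 0 < n \<Longrightarrow> 1 \<le> E n \<longleftrightarrow> n0 dvd n"
    using subtractive_set_multiples[of "\<lambda>n. 1 \<le> E n" n1] S[of 1] by (metis insertCI)
  show ?thesis
  proof (cases "\<exists>n>0. 2 \<le> E n")
    case False
    have "E n = 1 * (if n0 dvd n then 1 else 0) + 0 * (if n0 dvd n then 1 else 0)" if "0 < n" for n
    proof -
      have "\<not> 2 \<le> E n" using False that by blast
      then show ?thesis using n0(2)[OF that] by (cases "n0 dvd n") auto
    qed
    then show ?thesis using n0(1) by (metis dvd_refl)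
  next
    case True
    then obtain n2 where "0 < n2" "2 \<le> E n2" by blast
    then obtain r0 where r0: "0 < r0" "\<And>n. 0 < n \<Longrightarrow> 2 \<le> E n \<longleftrightarrow> r0 dvd n"
      using subtractive_set_multiples[of "\<lambda>n. 2 \<le> E n" n2] S[of 2] by (metis insertCI)
    have r2: "2 \<le> E r0" using r0 by simp
    have d: "n0 dvd r0" using n0(2)[OF r0(1)] r2 by simp
    \<comment> \<open>At multiples of the period the multiplicity is 1 until the multiplier becomes
      1; from \<open>r0\<close> on, the constant surplus \<open>E r0 - 1\<close> is added.\<close>
    have "E n = 1 * (if n0 dvd n then 1 else 0) + (E r0 - 1) * (if r0 dvd n then 1 else 0)" if "0 < n" for n
    proof (cases "r0 dvd n")
      case True
      then obtain k where "n = k * r0" by (metis dvd_def mult.commute)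
      then have "E n = E r0" using C[OF r0(1) _ r2, of k] that by simp
      then show ?thesis using True d r2 by (auto dest: dvd_trans)
    next
      case False
      then have "\<not> 2 \<le> E n" using r0(2)[OF that] by simp
      then show ?thesis using False n0(2)[OF that] by (cases "n0 dvd n") auto
    qed
    then show ?thesis using n0(1) r0(1) d by metis
  qed
qed

lemma proper_divisor_prime:
  fixes r n :: nat
  assumes "r dvd n" "r \<noteq> n" "0 < n"
  obtains l where "Factorial_Ring.prime l" "l dvd n" "r dvd n div l"
proof -
  obtain s where s: "n = r * s" using assms(1) by (auto elim: dvdE)
  then have "s \<noteq> 1" using assms by auto
  then obtain l where l: "Factorial_Ring.prime l" "l dvd s" using prime_factor_nat by blast
  then obtain t where "s = l * t" by (auto elim: dvdE)
  then have "n div l = r * t" using s l(1) by (simp add: prime_gt_0_nat mult.left_commute)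
  then show ?thesis using that l s by simp
qed

lemma moebius_transform_shape:
  assumes "\<And>n. 0 < n \<Longrightarrow> E n = b * (if n0 dvd n then 1 else 0) + c * (if r0 dvd n then 1 else 0)"
    and "0 < n0" "0 < r0" "0 < n"
  shows "moebius_transform E n = int b * (if n = n0 then 1 else 0) + int c * (if n = r0 then 1 else 0)"
proof -
  have "moebius_transform E n = (\<Sum>k | k dvd n. int b * (moebius_mu (n div k) * (if n0 dvd k then 1 else 0)) +
      int c * (moebius_mu (n div k) * (if r0 dvd k then 1 else 0)))"
    unfolding moebius_transform_def
  proof (rule sum.cong[OF refl])
    fix k assume "k \<in> {k. k dvd n}"
    then have "0 < k" using assms(4) by (auto intro: Nat.gr0I)
    then show "moebius_mu (n div k) * int (E k) = int b * (moebius_mu (n div k) * (if n0 dvd k then 1 else 0)) +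
      int c * (moebius_mu (n div k) * (if r0 dvd k then 1 else 0))"
      by (simp add: assms(1) algebra_simps)
  qed
  also have "\<dots> = int b * (if n = n0 then 1 else 0) + int c * (if n = r0 then 1 else 0)"
    unfolding sum.distrib sum_distrib_left[symmetric]
    by (simp only: sum_moebius_mu_multiples assms)
  finally show ?thesis .
qed

text \<open>The transform is concentrated at \<open>n0\<close> and \<open>r0\<close> with weights b
  and c. If it vanishes at n although \<open>E n\<close> is positive, the multiplicity at n comes
  from a proper divisor, so some n/l already attains it.\<close>

lemma char_0_multiplicities:
  fixes E :: "nat \<Rightarrow> nat"
  assumes S: "\<And>j m n. j \<in> {1, 2} \<Longrightarrow> 0 < m \<Longrightarrow> 0 < n \<Longrightarrow> j \<le> E n \<Longrightarrow> j \<le> E (m + n) \<longleftrightarrow> j \<le> E m"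
    and C: "\<And>n k. 0 < n \<Longrightarrow> 0 < k \<Longrightarrow> 2 \<le> E n \<Longrightarrow> E (k * n) = E n"
  shows "0 < n \<Longrightarrow> moebius_transform E n \<ge> 0"
    and "0 < n \<Longrightarrow> moebius_transform E n = 0 \<Longrightarrow> 0 < E n \<Longrightarrow> \<exists>l. Factorial_Ring.prime l \<and> l dvd n \<and> E n \<le> E (n div l)"
    and "\<exists>B. \<forall>n>0. E n \<le> B"
proof -
  obtain b c n0 r0 where *: "0 < n0" "0 < r0" "n0 dvd r0"
    and E: "\<And>n. 0 < n \<Longrightarrow> E n = b * (if n0 dvd n then 1 else 0) + c * (if r0 dvd n then 1 else 0)"
    using fixed_multiplicity_shape[of E, OF S C] by auto
  note a = moebius_transform_shape[OF E *(1,2)]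
  show "0 < n \<Longrightarrow> moebius_transform E n \<ge> 0" by (simp add: a)
  have "E n \<le> b + c" if "0 < n" for n by (simp add: E[OF that])
  then show "\<exists>B. \<forall>n>0. E n \<le> B" by blast
  assume n: "0 < n" "moebius_transform E n = 0" "0 < E n"
  then have bc: "b = 0 \<or> n \<noteq> n0" "c = 0 \<or> n \<noteq> r0" by (auto simp: a split: if_splits)
  have pos: "0 < n div l" if "Factorial_Ring.prime l" "l dvd n" for l
    using that n(1) by (auto elim!: dvdE)
  show "\<exists>l. Factorial_Ring.prime l \<and> l dvd n \<and> E n \<le> E (n div l)"
  proof (cases "c \<noteq> 0 \<and> r0 dvd n")
    case True
    then obtain l where l: "Factorial_Ring.prime l" "l dvd n" "r0 dvd n div l"
      using proper_divisor_prime[of r0 n] bc n by blast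
    then have "n0 dvd n div l" using *(3) dvd_trans by blast
    then have "E n \<le> E (n div l)" using l n(1) pos[OF l(1,2)] by (simp add: E)
    then show ?thesis using l by blast
  next
    case False
    then have En: "E n = b * (if n0 dvd n then 1 else 0)" using E[OF n(1)] by auto
    then have "b \<noteq> 0" "n0 dvd n" using n(3) by (auto split: if_splits)
    then obtain l where l: "Factorial_Ring.prime l" "l dvd n" "n0 dvd n div l"
      using proper_divisor_prime[of n0 n] bc n by blast
    then have "E n \<le> E (n div l)" using En pos[OF l(1,2)] by (simp add: E)
    then show ?thesis using l by blast
  qed
qed

section \<open>Existence and degree of the dynatomic polynomial\<close>

lemma to_fract_prod: "to_fract (prod g A) = (\<Prod>i\<in>A. to_fract (g i))"
  by (induction A rule: infinite_finite_induct) simp_all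

lemma moebius_mu_cases: "moebius_mu n = 1 \<or> moebius_mu n = -1 \<or> moebius_mu n = 0"
  by (cases "even (card (prime_factors n))") (auto simp: moebius_mu_def)

text \<open>Sorting the factors by the sign of the Moebius function gives a quotient A/B.
  Nonnegative transforms say that B has no larger multiplicity than A anywhere, so B divides A over
  K.\<close>

lemma dynatomic_polynomial:
  fixes \<phi> :: "'k::field ratmap"
  assumes n: "n > 0"
    and pp: "\<And>k. 0 < k \<Longrightarrow> homogeneous2 (d ^ k + 1) (period_poly \<phi> k) \<and> period_poly \<phi> k \<noteq> 0"
    and nn: "\<And>P. moebius_transform (\<lambda>k. mult_at P (period_poly \<phi> k)) n \<ge> 0"
  obtains D where "homogeneous2 D (dynatomic \<phi> n)" "dynatomic \<phi> n \<noteq> 0"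
    "\<And>P. int (mult_at P (dynatomic \<phi> n)) = moebius_transform (\<lambda>k. mult_at P (period_poly \<phi> k)) n"
    "int D = moebius_transform (\<lambda>k. d ^ k + 1) n"
proof -
  let ?S = "\<lambda>s. {k. k dvd n \<and> moebius_mu (n div k) = s}"
  define A where "A = (\<Prod>k\<in>?S 1. period_poly \<phi> k)"
  define B where "B = (\<Prod>k\<in>?S (-1). period_poly \<phi> k)"
  define nA where "nA = (\<Sum>k\<in>?S 1. d ^ k + 1)"
  define nB where "nB = (\<Sum>k\<in>?S (-1). d ^ k + 1)"
  have fin: "finite {k. k dvd n}" using n by simp
  have finS: "finite (?S s)" for s by (rule finite_subset[OF _ fin]) auto
  have pos: "0 < k" if "k dvd n" for k using that n by (auto intro: Nat.gr0I)
  have split: "moebius_transform F n = (\<Sum>k\<in>?S 1. int (F k)) - (\<Sum>k\<in>?S (-1). int (F k))" for F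
  proof -
    have "moebius_transform F n = (\<Sum>k\<in>?S 1 \<union> ?S (-1). moebius_mu (n div k) * int (F k))"
      unfolding moebius_transform_def using fin moebius_mu_cases by (intro sum.mono_neutral_right) auto
    also have "\<dots> = (\<Sum>k\<in>?S 1. moebius_mu (n div k) * int (F k)) + (\<Sum>k\<in>?S (-1). moebius_mu (n div k) * int (F k))"
      using finS by (intro sum.union_disjoint) auto
    also have "\<dots> = (\<Sum>k\<in>?S 1. int (F k)) - (\<Sum>k\<in>?S (-1). int (F k))"
      by (simp add: sum_negf)
    finally show ?thesis .
  qed
  have hA: "homogeneous2 nA A" and hB: "homogeneous2 nB B"
    unfolding A_def nA_def B_def nB_def using pp pos by (auto intro!: homogeneous2_prod)
  have zA: "A \<noteq> 0" and zB: "B \<noteq> 0" unfolding A_def B_def using finS pp pos by auto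
  have mA: "mult_at P A = (\<Sum>k\<in>?S 1. mult_at P (period_poly \<phi> k))" for P
    unfolding A_def using pp pos by (intro mult_at_prod[where n = "\<lambda>k. d ^ k + 1"] finS) auto
  have mB: "mult_at P B = (\<Sum>k\<in>?S (-1). mult_at P (period_poly \<phi> k))" for P
    unfolding B_def using pp pos by (intro mult_at_prod[where n = "\<lambda>k. d ^ k + 1"] finS) auto
  have mAB: "int (mult_at P A) - int (mult_at P B) = moebius_transform (\<lambda>k. mult_at P (period_poly \<phi> k)) n" for P
    by (simp add: split mA mB)
  have "mult_at P B \<le> mult_at P A" for P using mAB[of P] nn[of P] by linarith
  then obtain C where C: "homogeneous2 (nA - nB) C" "A = B * C" "nB \<le> nA"
    using homogeneous2_dvdI[OF hA zA hB zB] by blast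
  have zC: "C \<noteq> 0" using C zA by auto
  have "(\<Prod>k | k dvd n. to_fract (period_poly \<phi> k) powi moebius_mu (n div k)) =
      (\<Prod>k\<in>?S 1 \<union> ?S (-1). to_fract (period_poly \<phi> k) powi moebius_mu (n div k))"
  proof (rule prod.mono_neutral_right[OF fin])
    show "\<forall>k\<in>{k. k dvd n} - (?S 1 \<union> ?S (-1)). to_fract (period_poly \<phi> k) powi moebius_mu (n div k) = 1"
    proof
      fix k assume "k \<in> {k. k dvd n} - (?S 1 \<union> ?S (-1))"
      then have "moebius_mu (n div k) = 0" using moebius_mu_cases[of "n div k"] by auto
      then show "to_fract (period_poly \<phi> k) powi moebius_mu (n div k) = 1" by simp
    qed
  qed auto
  also have "\<dots> = (\<Prod>k\<in>?S 1. to_fract (period_poly \<phi> k) powi moebius_mu (n div k)) *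
      (\<Prod>k\<in>?S (-1). to_fract (period_poly \<phi> k) powi moebius_mu (n div k))"
    using finS by (intro prod.union_disjoint) auto
  also have "\<dots> = to_fract A * inverse (to_fract B)"
    unfolding A_def B_def to_fract_prod prod_inversef[symmetric]
    by (intro arg_cong2[of _ _ _ _ "(*)"] prod.cong) (auto simp: comp_def power_int_minus)
  also have "\<dots> = to_fract C" using zB by (simp add: C(2))
  finally have eq: "(\<Prod>k | k dvd n. to_fract (period_poly \<phi> k) powi moebius_mu (n div k)) = to_fract C" .
  have dyn: "dynatomic \<phi> n = C" unfolding dynatomic_def eq by simp
  show ?thesis
  proof (rule that[of "nA - nB"])
    show "homogeneous2 (nA - nB) (dynatomic \<phi> n)" "dynatomic \<phi> n \<noteq> 0" using dyn C zC by simp_all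
    show "int (mult_at P (dynatomic \<phi> n)) = moebius_transform (\<lambda>k. mult_at P (period_poly \<phi> k)) n" for P
      using mult_at_mult[OF hB zB C(1) zC, of P] mAB[of P] C(2) by (simp add: dyn)
    show "int (nA - nB) = moebius_transform (\<lambda>k. d ^ k + 1) n"
      using C(3) by (simp add: split nA_def nB_def of_nat_diff)
  qed
qed

lemma sum_pow_le:
  fixes d :: nat
  assumes "d \<ge> 2"
  shows "(\<Sum>k=1..m. d ^ k + 1) \<le> 2 * d ^ (m + 1)"
proof -
  have "(\<Sum>k=1..m. d ^ k + 1) + 2 \<le> 2 * d ^ (m + 1)"
  proof (induction m)
    case 0
    show ?case using assms by simp
  next
    case (Suc m)
    have "1 \<le> d ^ (m + 1)" using assms by simp
    moreover have "2 * d ^ (m + 1) \<le> d ^ (Suc m + 1)" using assms by simp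
    moreover have "(\<Sum>k=1..Suc m. d ^ k + 1) = (\<Sum>k=1..m. d ^ k + 1) + (d ^ (m + 1) + 1)" by simp
    ultimately show ?case using Suc by linarith
  qed
  then show ?thesis by simp
qed

lemma proper_divisor_le_half:
  fixes k n :: nat
  assumes "k dvd n" "k \<noteq> n" "n > 0"
  shows "k \<in> {1..n div 2}"
proof -
  obtain s where s: "n = k * s" using assms(1) by (auto elim: dvdE)
  then have "s \<ge> 2" "k \<ge> 1" using assms by (cases s; auto)+
  then have "k * 2 \<le> n" using s by simp
  then show ?thesis using \<open>k \<ge> 1\<close> by auto
qed

text \<open>The term d^n + 1 dominates: all other divisors are at most q = n/2 and contribute at
  most 2 d^(q+1). It is applied with n = pN and m = N, where p \<ge> 2 and N \<ge> 3 give n \<ge>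
  6.\<close>

lemma dynatomic_degree_bound:
  fixes d n m :: nat
  assumes "d \<ge> 2" "n \<ge> 6" "m \<le> n div 2"
  shows "int (d ^ m + 1) < moebius_transform (\<lambda>k. d ^ k + 1) n"
proof -
  define q where "q = n div 2"
  have q: "q \<ge> 3" "2 * q \<le> n" using assms(2) by (auto simp: q_def)
  have fin: "finite {k. k dvd n}" using assms(2) by simp
  have mu: "moebius_mu k \<ge> -1" for k using moebius_mu_cases[of k] by auto
  have m1: "moebius_mu 1 = 1" by (simp add: moebius_mu_def)
  have "moebius_transform (\<lambda>k. d ^ k + 1) n = moebius_mu (n div n) * int (d ^ n + 1) +
      (\<Sum>k\<in>{k. k dvd n} - {n}. moebius_mu (n div k) * int (d ^ k + 1))"
    unfolding moebius_transform_def using fin by (intro sum.remove) auto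
  moreover have "moebius_mu (n div n) * int (d ^ n + 1) = int (d ^ n + 1)" using assms(2) m1 by simp
  moreover have "(\<Sum>k\<in>{k. k dvd n} - {n}. moebius_mu (n div k) * int (d ^ k + 1)) \<ge>
      (\<Sum>k\<in>{k. k dvd n} - {n}. - int (d ^ k + 1))"
  proof (rule sum_mono)
    fix k
    show "- int (d ^ k + 1) \<le> moebius_mu (n div k) * int (d ^ k + 1)"
      using mult_right_mono[OF mu[of "n div k"], of "int (d ^ k + 1)"] by simp
  qed
  moreover have "(\<Sum>k\<in>{k. k dvd n} - {n}. - int (d ^ k + 1)) = - int (\<Sum>k\<in>{k. k dvd n} - {n}. d ^ k + 1)"
    unfolding of_nat_sum by (rule sum_negf)
  ultimately have 1: "moebius_transform (\<lambda>k. d ^ k + 1) n \<ge> int (d ^ n + 1) - int (\<Sum>k\<in>{k. k dvd n} - {n}. d ^ k + 1)"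
    by linarith
  have "(\<Sum>k\<in>{k. k dvd n} - {n}. d ^ k + 1) \<le> (\<Sum>k=1..q. d ^ k + 1)"
  proof (rule sum_mono2)
    show "{k. k dvd n} - {n} \<subseteq> {1..q}"
    proof
      fix k assume "k \<in> {k. k dvd n} - {n}"
      then show "k \<in> {1..q}" unfolding q_def using assms(2) by (intro proper_divisor_le_half) auto
    qed
  qed auto
  also have "\<dots> \<le> 2 * d ^ (q + 1)" by (rule sum_pow_le[OF assms(1)])
  finally have 2: "(\<Sum>k\<in>{k. k dvd n} - {n}. d ^ k + 1) \<le> 2 * d ^ (q + 1)" .
  \<comment> \<open>The bound q \<ge> 3 enters here: 2d + 1 < 4d \<le> d^3 \<le> d^q.\<close>
  have "2 * d + 1 < 2 * 2 * d" using assms(1) by simp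
  also have "\<dots> \<le> d ^ 3" using mult_le_mono[OF mult_le_mono[OF assms(1) assms(1)] order_refl, of d] by (simp add: power3_eq_cube)
  also have "\<dots> \<le> d ^ q" using q assms(1) by (intro power_increasing) auto
  finally have "2 * d + 1 < d ^ q" .
  then have "(2 * d + 1) * d ^ q < d ^ q * d ^ q" using assms(1) by (intro mult_strict_right_mono) auto
  also have "\<dots> = d ^ (2 * q)" by (simp add: power_add mult_2)
  also have "\<dots> \<le> d ^ n" using q assms(1) by (intro power_increasing) auto
  finally have "2 * d ^ (q + 1) + d ^ q < d ^ n" by (simp add: algebra_simps)
  moreover have "d ^ m \<le> d ^ q" using assms by (intro power_increasing) (auto simp: q_def)
  ultimately have "2 * d ^ (q + 1) + d ^ m < d ^ n" by linarith
  then have "int (2 * d ^ (q + 1)) + int (d ^ m) < int (d ^ n)" by linarith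
  then show ?thesis using 1 2 by linarith
qed



subsection \<open>The maps \<open>h\<^sup>a \<circ> \<phi>\<^sup>n\<close>\<close>

locale ratmap_automorphism =
  fixes \<phi> :: "'k::field ratmap" and h :: "'k ^ 2 ^ 2" and d p :: nat
  assumes rational_map: "rational_map d \<phi>" and d2: "d \<ge> 2" and h_GL2: "h \<in> carrier GL2"
    and automorphism: "is_automorphism h \<phi>" and prime_p: "Factorial_Ring.prime p"
    and ord_h: "group.ord PGL2 (pgl_class h) = p"
begin

abbreviation f :: "'k alg_closure fvec \<Rightarrow> 'k alg_closure fvec" where "f \<equiv> map_of_ratmap \<phi>"
abbreviation g :: "'k alg_closure fvec \<Rightarrow> 'k alg_closure fvec" where "g \<equiv> map_of_ratmap (ratmap_of_matrix h)"

definition twist :: "nat \<Rightarrow> nat \<Rightarrow> 'k alg_closure fvec \<Rightarrow> 'k alg_closure fvec" where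
  "twist a n V = (g ^^ a) ((f ^^ n) V)"

definition twist_ratmap :: "nat \<Rightarrow> nat \<Rightarrow> 'k ratmap" where
  "twist_ratmap a n = ratmap_comp (ratmap_iter (ratmap_of_matrix h) a) (ratmap_iter \<phi> n)"

definition fix_mult :: "'k alg_closure option \<Rightarrow> nat \<Rightarrow> nat \<Rightarrow> nat" where
  "fix_mult P a n = mult_at P (fixpoly (twist_ratmap a n))"

lemma map_of_ratmap_twist_ratmap: "map_of_ratmap (twist_ratmap a n) = twist a n"
  by (rule ext) (simp add: twist_ratmap_def twist_def map_of_ratmap_comp map_of_ratmap_iter)

lemma invertible_h: "invertible h"
  using h_GL2 by (simp add: GL2_def)

lemma homog_map_f: "homog_map d f"
  using homog_map_rational_map[OF rational_map] d2 by simp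

lemma homog_map_g: "homog_map 1 g"
  by (rule homog_map_matrix[OF invertible_h])

lemma homog_map_gn: "homog_map 1 (g ^^ a)"
  using homog_map_funpow[OF homog_map_g, of a] by simp

lemma homog_map_twist: "homog_map (d ^ n) (twist a n)"
  using homog_map_comp[OF homog_map_gn homog_map_funpow[OF homog_map_f, of n], of a]
  by (simp add: twist_def[abs_def])

lemma hpair_twist_ratmap: "hpair (d ^ n) (twist_ratmap a n)"
proof -
  have "hpair d \<phi>" using rational_map by (simp add: rational_map_def hpair_def)
  then show ?thesis
    using hpair_comp[OF hpair_iter[OF hpair_matrix, of a h] hpair_iter[of d \<phi> n]] by (simp add: twist_ratmap_def)
qed

lemma homogeneous2_twist_ratmap: "homogeneous2 (d ^ n + 1) (fixpoly (twist_ratmap a n))"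
  by (rule homogeneous2_fixpoly[OF hpair_twist_ratmap])

lemma fixpoly_twist_ratmap_nonzero: "0 < n \<Longrightarrow> fixpoly (twist_ratmap a n) \<noteq> 0"
proof (rule fixpoly_nonzero[OF hpair_twist_ratmap])
  assume "0 < n"
  then have "d ^ 1 \<le> d ^ n" using d2 by (intro power_increasing) auto
  then show "2 \<le> d ^ n" using d2 by simp
  show "homog_map (d ^ n) (map_of_ratmap (twist_ratmap a n))" using homog_map_twist by (simp add: map_of_ratmap_twist_ratmap)
qed

lemma twist_ratmap_0_left: "twist_ratmap 0 n = ratmap_iter \<phi> n"
  by (simp add: twist_ratmap_def ratmap_comp_def subst2_eval2 eval2_varx eval2_vary ring_morphism_const2)

text \<open>The pair (1, 0) stands for h itself, of degree 1, where \<open>fixpoly_nonzero\<close>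
  does not apply; h being nonscalar takes its place.\<close>

lemma fixpoly_h_nonzero: "fixpoly (twist_ratmap 1 0) \<noteq> 0"
proof -
  have "eval2 const2 P varx vary = P" if "homogeneous2 m P" for P :: "'k bipoly" and m
    using eval2_homogeneous[OF ring_morphism_const2 that] homogeneous2_expand[OF that] by simp
  from this[of 1 "fst (ratmap_of_matrix h)"] this[of 1 "snd (ratmap_of_matrix h)"]
  have "twist_ratmap 1 0 = ratmap_of_matrix h"
    using hpair_matrix[of h]
    by (simp add: twist_ratmap_def ratmap_comp_def subst2_eval2 eval2_varx eval2_vary ring_morphism_const2 hpair_def prod_eq_iff)
  then show ?thesis
    using fixpoly_matrix_nonzero[OF invertible_h pgl_order(1)[OF h_GL2 ord_h prime_p]] by simp
qed

text \<open>The index condition keeps out cases such as the identity (0, 0), whose fixed point form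
  is 0 and has no meaningful \<open>mult_at\<close>.\<close>

lemma le_fix_mult_iff: "0 < n \<or> (a = 1 \<and> n = 0) \<Longrightarrow> j \<le> fix_mult P a n \<longleftrightarrow> fix_order_ge P j (twist a n)"
  using le_mult_at_iff[OF homogeneous2_twist_ratmap[of n a], of j P] fixpoly_twist_ratmap_nonzero[of n a] fixpoly_h_nonzero
  by (auto simp: fix_mult_def fix_order_ge_def fix_det_map_of_ratmap simp flip: map_of_ratmap_twist_ratmap)

lemma gp_scalar: "same_map (g ^^ p) (\<lambda>V. V)"
proof -
  obtain c where c: "h [^]\<^bsub>GL2\<^esub> p = mat c" "c \<noteq> 0"
    using pgl_order(2)[OF h_GL2 ord_h prime_p] by (auto simp: scalars2_def)
  have "(g ^^ p) V = smul (fps_const (to_ac c)) V" for V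
    using map_of_ratmap_matrix_pow[of h p] c(1) by (metis map_of_ratmap_mat)
  then show ?thesis
    unfolding same_map_def using c(2) by (intro allI impI exI[of _ "fps_const (to_ac c)"]) simp
qed

lemma fg_commute: "same_map (\<lambda>V. (f ^^ n) ((g ^^ a) V)) (\<lambda>V. (g ^^ a) ((f ^^ n) V))"
proof -
  have 1: "same_map (\<lambda>V. f ((g ^^ a) V)) (\<lambda>V. (g ^^ a) (f V))"
    by (rule same_commute_funpow[OF homog_map_f homog_map_g automorphism_commute[OF homog_map_f invertible_h automorphism]])
  show ?thesis
    by (rule same_sym[OF same_commute_funpow[OF homog_map_gn homog_map_f same_sym[OF 1]]])
qed

text \<open>With \<open>twist_p\<close>, the pairs (a, n) compose like elements of Z/p x N, up to
  units.\<close>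

lemma twist_comp: "same_map (\<lambda>V. twist a n (twist b m V)) (twist (a + b) (n + m))"
proof -
  have "same_map (\<lambda>V. (f ^^ n) ((g ^^ b) ((f ^^ m) V))) (\<lambda>V. (g ^^ b) ((f ^^ n) ((f ^^ m) V)))"
    by (rule same_comp_right[OF homog_map_funpow[OF homog_map_f] fg_commute])
  from same_comp_left[OF homog_map_gn this, of a] show ?thesis
    by (simp add: twist_def funpow_add comp_def twist_def[abs_def])
qed

lemma twist_funpow: "same_map (twist a n ^^ k) (twist (k * a) (k * n))"
proof (induction k)
  case 0
  show ?case by (simp add: twist_def[abs_def] same_refl id_def)
next
  case (Suc k)
  have "same_map (\<lambda>V. twist a n ((twist a n ^^ k) V)) (\<lambda>V. twist a n (twist (k * a) (k * n) V))"
    by (rule same_comp_left[OF homog_map_twist Suc])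
  from same_trans[OF this twist_comp] show ?case by (simp add: comp_def)
qed

lemma twist_p: "same_map (twist (a + p * k) n) (twist a n)"
proof (induction k)
  case (Suc k)
  have "same_map (\<lambda>V. (g ^^ p) (twist (a + p * k) n V)) (twist (a + p * k) n)"
    using same_comp_right[OF homog_map_twist gp_scalar] by simp
  moreover have "(\<lambda>V. (g ^^ p) (twist (a + p * k) n V)) = twist (a + p * Suc k) n"
    by (rule ext) (simp add: twist_def add.left_commute[of _ p] funpow_add comp_def del: funpow.simps)
  ultimately show ?case using same_trans Suc by metis
qed (simp add: same_refl)

lemma fix_mult_p:
  assumes "0 < n"
  shows "fix_mult P (a + p * k) n = fix_mult P a n"
  using le_fix_mult_iff[OF disjI1[OF assms]] fix_order_ge_same[OF twist_p] by (metis order_refl le_antisym)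

text \<open>Cancellation law: a map that fixes P (and has multiplier 1 there if j = 2) can be
  removed from a composite. The case (1, 0) lets h itself be isolated.\<close>

lemma fix_mult_add:
  assumes "j \<in> {1, 2}" "0 < m" "j \<le> fix_mult P b m" "0 < n \<or> (a = 1 \<and> n = 0)"
  shows "j \<le> fix_mult P (a + b) (n + m) \<longleftrightarrow> j \<le> fix_mult P a n"
  using fix_order_ge_comp[OF homog_map_twist[of n a] homog_map_twist[of m b], of P j] assms
    fix_order_ge_same[OF twist_comp[of a n b m], of P j]
  by (simp add: le_fix_mult_iff)

lemma fix_mult_mono:
  assumes "0 < n" "0 < k"
  shows "fix_mult P a n \<le> fix_mult P (k * a) (k * n)"
  using fix_order_ge_funpow[OF homog_map_twist[of n a], of P "fix_mult P a n" k]
    fix_order_ge_same[OF twist_funpow[where a = a and n = n and k = k], of P "fix_mult P a n"]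
    le_fix_mult_iff[of n a "fix_mult P a n" P] assms by (simp add: le_fix_mult_iff[of "k * n" "k * a"])

lemma fix_mult_mult_eq:
  assumes "0 < n" "2 \<le> fix_mult P a n" "(of_nat k :: 'k alg_closure) \<noteq> 0"
  shows "fix_mult P (k * a) (k * n) = fix_mult P a n"
proof -
  have k: "0 < k" using assms(3) by (auto intro: Nat.gr0I)
  have "j \<le> fix_mult P (k * a) (k * n) \<longleftrightarrow> j \<le> fix_mult P a n" for j
    using fix_order_ge_funpow_iff[OF homog_map_twist[of n a], of P k j] assms k
      fix_order_ge_same[OF twist_funpow[where a = a and n = n and k = k], of P j]
    by (simp add: le_fix_mult_iff)
  then show ?thesis by (metis order_refl le_antisym)
qed

lemma fix_mult_multiplier:
  assumes "0 < n" "1 \<le> fix_mult P a n"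
  obtains \<mu> :: "'k alg_closure" where "\<And>k. 0 < k \<Longrightarrow> 2 \<le> fix_mult P (k * a) (k * n) \<longleftrightarrow> \<mu> ^ k = 1"
proof -
  have "fix_order_ge P 1 (twist a n)" using assms by (simp add: le_fix_mult_iff)
  then obtain \<mu> :: "'k alg_closure" where "\<And>k. fix_order_ge P 2 (twist a n ^^ k) \<longleftrightarrow> \<mu> ^ k = 1"
    using multiplier_exists[OF homog_map_twist] by blast
  then show ?thesis using that[of \<mu>] fix_order_ge_same[OF twist_funpow[where a = a and n = n], of P 2] assms by (simp add: le_fix_mult_iff)
qed

lemma sum_fix_mult:
  assumes "0 < n"
  shows "finite {P. fix_mult P a n > 0}" "(\<Sum>P | fix_mult P a n > 0. fix_mult P a n) = d ^ n + 1"
    "finite S \<Longrightarrow> (\<Sum>P\<in>S. fix_mult P a n) \<le> d ^ n + 1"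
  using sum_mult_at[OF homogeneous2_twist_ratmap fixpoly_twist_ratmap_nonzero[OF assms]]
    sum_mult_at_le[OF homogeneous2_twist_ratmap fixpoly_twist_ratmap_nonzero[OF assms]] by (simp_all add: fix_mult_def)

lemma finite_fixed_h: "finite {P. fix_mult P 1 0 > 0}"
  using sum_mult_at(1)[OF homogeneous2_twist_ratmap fixpoly_h_nonzero] by (simp add: fix_mult_def)

text \<open>The fixed point form of \<open>h \<circ> \<phi>^N\<close> shares the zero P with the
  dynatomic polynomial, hence a factor C over K whose degree is at most d^N + 1.\<close>

lemma dynatomic_reducible:
  assumes "3 \<le> N" and nn: "\<And>P. moebius_transform (fix_mult P 0) (p * N) \<ge> 0"
    and P: "0 < fix_mult P 1 N" "0 < moebius_transform (fix_mult P 0) (p * N)"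
  shows "reducible2 (dynatomic \<phi> (p * N))"
proof -
  let ?n = "p * N" and ?C = "dynatomic \<phi> (p * N)"
  have p2: "2 \<le> p" using prime_p by (rule prime_ge_2_nat)
  have pe: "(\<lambda>k. mult_at P (period_poly \<phi> k)) = fix_mult P 0" for P
    by (rule ext) (simp add: fix_mult_def twist_ratmap_0_left period_poly_fixpoly)
  have n0: "0 < ?n" using assms(1) p2 by simp
  obtain D where D: "homogeneous2 D ?C" "?C \<noteq> 0" "\<And>P. int (mult_at P ?C) = moebius_transform (fix_mult P 0) ?n"
    "int D = moebius_transform (\<lambda>k. d ^ k + 1) ?n"
    using dynatomic_polynomial[OF n0, of d \<phi>] nn homogeneous2_twist_ratmap[of _ 0] fixpoly_twist_ratmap_nonzero[of _ 0]
    unfolding pe by (auto simp: twist_ratmap_0_left period_poly_fixpoly)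
  have "2 * N \<le> p * N" using p2 by simp
  then have "int (d ^ N + 1) < int D"
    unfolding D(4) using assms(1) by (intro dynatomic_degree_bound d2) linarith+
  then have deg: "d ^ N + 1 < D" by linarith
  have N0: "0 < N" using assms(1) by simp
  have "0 < mult_at P ?C" using D(3)[of P] P(2) by linarith
  then obtain C k F where C: "homogeneous2 k C" "0 < k" "k \<le> D" "k \<le> d ^ N + 1" "?C = C * F"
    "homogeneous2 (D - k) F"
    using common_zero_factor[OF D(1,2) homogeneous2_twist_ratmap fixpoly_twist_ratmap_nonzero[OF N0], of P 1] P(1)
    unfolding fix_mult_def by metis
  have "\<not> C dvd 1" using homogeneous2_not_unit[OF C(1,2)] .
  \<comment> \<open>The cofactor has degree D - k, which is positive because k \<le> d^N + 1 <
    D.\<close>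
  moreover have "\<not> F dvd 1" using homogeneous2_not_unit[OF C(6)] C(4) deg by simp
  ultimately have "\<not> Factorial_Ring.irreducible ?C" using C(5) unfolding irreducible_def by blast
  moreover have "\<not> ?C dvd 1" using homogeneous2_not_unit[OF D(1)] deg by simp
  ultimately show ?thesis using D(2) by (simp add: reducible2_def)
qed

end

subsection \<open>Reducibility\<close>

lemma inverse_mod_exists:
  fixes l n :: nat
  assumes "coprime l n" "1 < n"
  obtains a t where "0 < a" "a < n" "l * a = 1 + t * n"
proof -
  obtain x where x: "[l * x = Suc 0] (mod n)" using cong_solve_coprime_nat[OF assms(1)] by blast
  define a where "a = x mod n"
  have la: "l * a mod n = 1" using x assms(2) by (simp add: a_def cong_def mod_mult_right_eq)
  then have "0 < a" using assms(2) by (cases "a = 0") auto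
  moreover have "a < n" using assms(2) by (simp add: a_def)
  moreover have "l * a = 1 + (l * a div n) * n" using la by (metis add.commute div_mult_mod_eq)
  ultimately show ?thesis by (rule that)
qed

lemma power_eq_1_coprime:
  fixes x :: "'a::monoid_mult"
  assumes "coprime m n" "x ^ m = 1" "x ^ n = 1" "0 < n"
  shows "x = 1"
proof (cases "n = 1")
  case False
  then have "1 < n" using assms(4) by simp
  then obtain a t where a: "m * a = 1 + t * n" using inverse_mod_exists[OF assms(1)] by blast
  have "1 = x ^ (m * a)" using assms(2) by (simp add: power_mult)
  also have "\<dots> = x" unfolding a using assms(3) by (simp add: power_mult mult.commute[of t])
  finally show ?thesis ..
qed (use assms in simp)

lemma prime_prime_divisors:
  fixes p q :: nat
  assumes "Factorial_Ring.prime p" "Factorial_Ring.prime q"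
  shows "{k. k dvd p * q} = {1, p, q, p * q}"
proof (intro equalityI subsetI)
  fix k assume "k \<in> {k. k dvd p * q}"
  then obtain a b where "k = a * b" "a dvd p" "b dvd q" using dvd_productE[of k p q] by blast
  moreover from this have "a = 1 \<or> a = p" "b = 1 \<or> b = q" using assms prime_nat_iff by blast+
  ultimately show "k \<in> {1, p, q, p * q}" by auto
qed auto

lemma moebius_transform_prime_prime:
  assumes "Factorial_Ring.prime p" "Factorial_Ring.prime q" "p \<noteq> q"
  shows "moebius_transform E (p * q) = int (E (p * q)) + int (E 1) - int (E p) - int (E q)"
proof -
  have pos: "1 < p" "1 < q" using assms prime_gt_1_nat by blast+
  have prime: "moebius_mu r = -1" if "Factorial_Ring.prime r" for r
    using that by (simp add: moebius_mu_def squarefree_prime prime_prime_factors)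
  have one: "moebius_mu 1 = 1" by (simp add: moebius_mu_def)
  have "coprime p q" using assms by (simp add: primes_coprime)
  then have "moebius_mu (p * q) = 1"
    using assms pos by (simp add: moebius_mu_def squarefree_mult_coprime squarefree_prime
        prime_factors_product prime_prime_factors)
  moreover have "1 \<noteq> p" "1 \<noteq> q" "p * q \<noteq> 1" "p * q \<noteq> p" "p * q \<noteq> q" using pos by auto
  ultimately show ?thesis
    unfolding moebius_transform_def prime_prime_divisors[OF assms(1,2)]
    using pos assms(3) prime[OF assms(1)] prime[OF assms(2)] one by simp
qed

context ratmap_automorphism
begin

lemma p_gt_1: "1 < p"
  using prime_p by (rule prime_gt_1_nat)

text \<open>The p-th iterate of \<open>h \<circ> \<phi>^N\<close> is \<open>\<phi>^(pN)\<close> up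
  to a unit.\<close>

lemma fix_mult_1_le_fix_mult_0: "0 < N \<Longrightarrow> fix_mult P 1 N \<le> fix_mult P 0 (p * N)"
  using fix_mult_mono[of N p P 1] fix_mult_p[of "p * N" P 0 1] p_gt_1 by simp

text \<open>\<open>\<phi>^N\<close> cancels from \<open>h \<circ> \<phi>^N\<close>.\<close>

lemma fix_mult_1_0_pos:
  assumes "0 < N" "0 < fix_mult P 1 N" "0 < fix_mult P 0 N"
  shows "0 < fix_mult P 1 0"
  using fix_mult_add[of 1 N P 0 0 1] assms by simp

text \<open>The period of P divides both m and n; concretely, the iterate 1 + tn is a multiple of m,
  and tn cancels.\<close>

lemma fix_mult_0_1_pos:
  assumes "0 < m" "0 < n" "coprime m n" "0 < fix_mult P 0 m" "0 < fix_mult P 0 n"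
  shows "0 < fix_mult P 0 1"
proof (cases "n = 1")
  case False
  then have "1 < n" using assms(2) by simp
  then obtain a t where a: "0 < a" "m * a = 1 + t * n" using inverse_mod_exists[OF assms(3)] by blast
  have "0 < fix_mult P 0 (1 + t * n)" using fix_mult_mono[OF assms(1) a(1), of P 0] assms(4) a(2) by (simp add: mult.commute)
  then show ?thesis
    using fix_mult_mono[OF assms(2), of t P 0] fix_mult_add[of 1 "t * n" P 0 1 0] assms by (cases "t = 0") auto
qed (use assms in simp)

text \<open>
  If \<open>l \<noteq> p\<close>, write \<open>N = l M\<close> and \<open>l a = 1 + t p\<close>. Then the \<open>l\<close>-th iterate of \<open>h\<^sup>a \<circ> \<phi>\<^sup>M\<close> is \<open>h \<circ> \<phi>\<^sup>N\<close>
  and its \<open>p\<close>-th iterate is \<open>\<phi>\<^bsup>pM\<^esup>\<close>; if both have multiplier 1 at \<open>P\<close>, so has \<open>h\<^sup>a \<circ> \<phi>\<^sup>M\<close>.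
\<close>

lemma root_bound_char_0:
  assumes char: "CHAR('k) = 0" and N: "0 < N" and e1: "0 < fix_mult P 1 N"
    and l: "Factorial_Ring.prime l" "l dvd p * N" "fix_mult P 0 (p * N) \<le> fix_mult P 0 (p * N div l)"
  shows "0 < fix_mult P 1 0 \<or> (\<exists>M a. M \<in> {1..N div 2} \<and> a < p \<and> fix_mult P 1 N \<le> fix_mult P a M)"
proof (cases "l = p")
  case True
  \<comment> \<open>Here \<open>p * N div l\<close> is N, so \<open>\<phi>^N\<close> fixes P as well
    as \<open>h \<circ> \<phi>^N\<close> does, and h is left.\<close>
  then have "0 < fix_mult P 0 N" using l(3) fix_mult_1_le_fix_mult_0[OF N, of P] e1 p_gt_1 by simp
  then show ?thesis using fix_mult_1_0_pos[OF N e1] by simp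
next
  case False
  then have co: "coprime l p" using l(1) prime_p by (simp add: primes_coprime)
  have "l dvd N" using l co by (simp add: coprime_dvd_mult_right_iff)
  then obtain M where M: "N = l * M" by (auto elim: dvdE)
  have l2: "2 \<le> l" using l(1) by (rule prime_ge_2_nat)
  have M0: "0 < M" using N M by simp
  have "2 * M \<le> N" using M l2 by simp
  then have Mr: "M \<in> {1..N div 2}" using M0 by auto
  have "p * N div l = p * M" using M l2 by simp
  then have e0: "fix_mult P 1 N \<le> fix_mult P 0 (p * M)" using l(3) fix_mult_1_le_fix_mult_0[OF N, of P] by simp
  have pM: "0 < p * M" using M0 p_gt_1 by simp
  obtain a t where a: "0 < a" "a < p" "l * a = 1 + t * p"
    using inverse_mod_exists[OF co p_gt_1] by blast
  have "a * N = (l * a) * M" by (simp add: M)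
  also have "\<dots> = M + t * (p * M)" unfolding a(3) by (simp add: algebra_simps)
  finally have aN: "a * N = M + t * (p * M)" .
  have "0 < fix_mult P a (a * N)" using fix_mult_mono[OF N a(1), of P 1] e1 by simp
  \<comment> \<open>The a-th iterate of \<open>h \<circ> \<phi>^N\<close> is
    \<open>h^a \<circ> \<phi>^M\<close> composed with t copies of \<open>\<phi>^(pM)\<close>; the
    latter fixes P by \<open>e0\<close> and cancels.\<close>
  then have eaM: "1 \<le> fix_mult P a M"
    using fix_mult_mono[OF pM, of t P 0] fix_mult_add[of 1 "t * (p * M)" P 0 M a] e0 e1 M0 p_gt_1
    by (cases "t = 0") (auto simp: aN)
  have "l * a = 1 + p * t" using a(3) by simp
  then have el: "fix_mult P (l * a) (l * M) = fix_mult P 1 N" using fix_mult_p[OF N, of P 1 t] M by simp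
  have "fix_mult P 1 N \<le> fix_mult P a M"
  proof (cases "2 \<le> fix_mult P 1 N")
    case True
    obtain \<mu> :: "'k alg_closure" where \<mu>: "\<And>k. 0 < k \<Longrightarrow> 2 \<le> fix_mult P (k * a) (k * M) \<longleftrightarrow> \<mu> ^ k = 1"
      using fix_mult_multiplier[OF M0 eaM] by blast
    \<comment> \<open>\<mu> is the multiplier of \<open>h^a \<circ> \<phi>^M\<close> at P; its l-th
      and p-th powers are those of \<open>h \<circ> \<phi>^N\<close> and
      \<open>\<phi>^(pM)\<close>.\<close>
    have "\<mu> ^ l = 1" using \<mu>[of l] l2 el True by simp
    moreover have "\<mu> ^ p = 1" using \<mu>[of p] p_gt_1 fix_mult_p[OF pM, of P 0 a] e0 True by simp
    ultimately have "\<mu> = 1" using power_eq_1_coprime[OF co] p_gt_1 by simp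
    then have "2 \<le> fix_mult P a M" using \<mu>[of 1] by simp
    moreover have "(of_nat l :: 'k alg_closure) \<noteq> 0"
      using char l2 by (simp add: of_nat_eq_0_iff_char_dvd)
    ultimately show ?thesis using fix_mult_mult_eq[OF M0] el by simp
  qed (use eaM in simp)
  then show ?thesis using Mr a by blast
qed

lemma fix_mult_subtractive:
  "j \<in> {1, 2} \<Longrightarrow> 0 < m \<Longrightarrow> 0 < n \<Longrightarrow> j \<le> fix_mult P 0 n \<Longrightarrow> j \<le> fix_mult P 0 (m + n) \<longleftrightarrow> j \<le> fix_mult P 0 m"
  using fix_mult_add[of j n P 0 m 0] by simp

lemma fix_mult_constant_char_0:
  "CHAR('k) = 0 \<Longrightarrow> 0 < n \<Longrightarrow> 0 < k \<Longrightarrow> 2 \<le> fix_mult P 0 n \<Longrightarrow> fix_mult P 0 (k * n) = fix_mult P 0 n"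
  using fix_mult_mult_eq[of n P 0 k] by (simp add: of_nat_eq_0_iff_char_dvd)

theorem finite_irreducible_char_0:
  assumes char: "CHAR('k) = 0"
  shows "finite {N. N > 0 \<and> \<not> reducible2 (dynatomic \<phi> (p * N))}"
proof -
  have E1: "moebius_transform (fix_mult P 0) n \<ge> 0" if "0 < n" for P n
    by (rule char_0_multiplicities(1)[of "fix_mult P 0"];
        (rule fix_mult_subtractive | rule fix_mult_constant_char_0[OF char] | rule that); assumption)
  have E2: "\<exists>l. Factorial_Ring.prime l \<and> l dvd n \<and> fix_mult P 0 n \<le> fix_mult P 0 (n div l)"
    if "0 < n" "moebius_transform (fix_mult P 0) n = 0" "0 < fix_mult P 0 n" for P n
    by (rule char_0_multiplicities(2)[of "fix_mult P 0"];
        (rule fix_mult_subtractive | rule fix_mult_constant_char_0[OF char] | rule that); assumption)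
  have E3: "\<exists>B. \<forall>n>0. fix_mult P 0 n \<le> B" for P
    by (rule char_0_multiplicities(3)[of "fix_mult P 0"];
        (rule fix_mult_subtractive | rule fix_mult_constant_char_0[OF char]); assumption)
  have "\<forall>P. \<exists>B. \<forall>n>0. fix_mult P 0 n \<le> B" using E3 by blast
  then obtain B where B: "\<And>P n. 0 < n \<Longrightarrow> fix_mult P 0 n \<le> B P" by metis
  \<comment> \<open>The bound \<open>B P\<close> depends on the point, but it is summed only over
    the finitely many fixed points of h.\<close>
  define H where "H = {P. fix_mult P 1 0 > 0}"
  define C where "C = (\<Sum>P\<in>H. B P)"
  have finH: "finite H" using finite_fixed_h by (simp add: H_def)
  \<comment> \<open>Chosen so that q = N/2 is at least 2pd + C + 1; then d^q exceeds this number
    too, and d^N \<ge> d^q d^q beats 2p d^(q+1) + C.\<close>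
  define K where "K = 2 * (2 * p * d + C + 1)"
  have "reducible2 (dynatomic \<phi> (p * N))" if N: "3 \<le> N" "K \<le> N" for N
  proof (rule ccontr)
    assume irr: "\<not> reducible2 (dynatomic \<phi> (p * N))"
    have N0: "0 < N" "0 < p * N" using N p_gt_1 by auto
    define S where "S = {P. fix_mult P 1 N > 0}"
    have finS: "finite S" using sum_fix_mult(1)[OF N0(1)] by (simp add: S_def)
    define q where "q = N div 2"
    \<comment> \<open>The pair (M, a) found for P varies with P, so it is replaced by the sum over
      all pairs.\<close>
    have bound: "fix_mult P 1 N \<le> (\<Sum>M\<in>{1..q}. \<Sum>a<p. fix_mult P a M) + (if P \<in> H then B P else 0)" if "P \<in> S" for P
    proof -
      have e1: "0 < fix_mult P 1 N" using that by (simp add: S_def)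
      have "\<not> 0 < moebius_transform (fix_mult P 0) (p * N)"
        using dynatomic_reducible[OF N(1) E1[OF N0(2)] e1] irr by blast
      then have "moebius_transform (fix_mult P 0) (p * N) = 0" using E1[OF N0(2), of P] by linarith
      then obtain l where l: "Factorial_Ring.prime l" "l dvd p * N" "fix_mult P 0 (p * N) \<le> fix_mult P 0 (p * N div l)"
        using E2[of "p * N" P] N0(2) fix_mult_1_le_fix_mult_0[OF N0(1), of P] e1 by fastforce
      show ?thesis
        using root_bound_char_0[OF char N0(1) e1 l]
      proof
        assume "0 < fix_mult P 1 0"
        then show ?thesis
          using B[OF N0(2), of P] fix_mult_1_le_fix_mult_0[OF N0(1), of P] by (simp add: H_def)
      next
        assume "\<exists>M a. M \<in> {1..N div 2} \<and> a < p \<and> fix_mult P 1 N \<le> fix_mult P a M"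
        then obtain M a where M: "M \<in> {1..q}" "a \<in> {..<p}" "fix_mult P 1 N \<le> fix_mult P a M" by (auto simp: q_def)
        have "fix_mult P a M \<le> (\<Sum>a<p. fix_mult P a M)" using M(2) by (intro member_le_sum) auto
        also have "\<dots> \<le> (\<Sum>M\<in>{1..q}. \<Sum>a<p. fix_mult P a M)"
          by (rule member_le_sum[where f = "\<lambda>M. \<Sum>a<p. fix_mult P a M"]) (use M(1) in auto)
        finally show ?thesis using M(3) by simp
      qed
    qed
    have "d ^ N + 1 = (\<Sum>P\<in>S. fix_mult P 1 N)" using sum_fix_mult(2)[OF N0(1)] by (simp add: S_def)
    also have "\<dots> \<le> (\<Sum>P\<in>S. (\<Sum>M\<in>{1..q}. \<Sum>a<p. fix_mult P a M) + (if P \<in> H then B P else 0))"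
      by (rule sum_mono[OF bound])
    also have "\<dots> = (\<Sum>P\<in>S. \<Sum>M\<in>{1..q}. \<Sum>a<p. fix_mult P a M) + (\<Sum>P\<in>S. if P \<in> H then B P else 0)"
      by (rule sum.distrib)
    also have "(\<Sum>P\<in>S. \<Sum>M\<in>{1..q}. \<Sum>a<p. fix_mult P a M) = (\<Sum>M\<in>{1..q}. \<Sum>a<p. \<Sum>P\<in>S. fix_mult P a M)"
      \<comment> \<open>With the sum over points innermost, each term counts fixed points of one map
        and is at most d^M + 1.\<close>
      by (subst sum.swap) (intro sum.cong refl sum.swap)
    also have "\<dots> \<le> (\<Sum>M\<in>{1..q}. \<Sum>a<p. d ^ M + 1)"
      using finS by (intro sum_mono sum_fix_mult(3)) auto
    also have "\<dots> = p * (\<Sum>M\<in>{1..q}. d ^ M + 1)" by (simp only: sum_constant card_lessThan sum_distrib_left of_nat_id)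
    also have "\<dots> \<le> p * (2 * d ^ (q + 1))" by (intro mult_left_mono sum_pow_le d2) auto
    also have "(\<Sum>P\<in>S. if P \<in> H then B P else 0) = (\<Sum>P\<in>S \<inter> H. B P)"
      using finS by (simp add: sum.inter_restrict)
    also have "\<dots> \<le> C" unfolding C_def using finH by (intro sum_mono2) auto
    finally have 1: "d ^ N + 1 \<le> p * (2 * d ^ (q + 1)) + C" by simp
    have q: "2 * p * d + C + 1 \<le> q" "2 * q \<le> N" using N(2) by (auto simp: K_def q_def)
    have "q < 2 ^ q" by (rule less_exp)
    also have "(2::nat) ^ q \<le> d ^ q" using d2 by (intro power_mono) auto
    finally have "2 * p * d + C + 1 \<le> d ^ q" using q(1) by simp
    then have "(2 * p * d + C + 1) * d ^ q \<le> d ^ q * d ^ q" by (rule mult_right_mono) simp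
    also have "\<dots> = d ^ (2 * q)" by (simp add: power_add mult_2)
    also have "\<dots> \<le> d ^ N" using q d2 by (intro power_increasing) auto
    finally have "(2 * p * d + C + 1) * d ^ q \<le> d ^ N" .
    moreover have "C * 1 \<le> C * d ^ q" using d2 by (intro mult_left_mono) auto
    moreover have "(2 * p * d + C + 1) * d ^ q = p * (2 * d ^ (q + 1)) + C * d ^ q + d ^ q"
      by (simp add: algebra_simps)
    ultimately show False using 1 by linarith
  qed
  then have "{N. N > 0 \<and> \<not> reducible2 (dynatomic \<phi> (p * N))} \<subseteq> {..<3 + K}"
    by (auto simp: not_less) (metis add_leE not_le add.commute)
  then show ?thesis by (rule finite_subset) simp
qed

text \<open>At multiplicity 2 or more only N = char can change it. At multiplicity 1 the multiplier
  \<mu> is not 1 and a change forces \<mu>^N = 1, which two different primes cannot both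
  satisfy.\<close>

lemma finite_primes_jump:
  assumes "0 < k" "0 < fix_mult P 0 k"
  shows "finite {N. Factorial_Ring.prime N \<and> fix_mult P 0 (k * N) \<noteq> fix_mult P 0 k}"
proof (cases "2 \<le> fix_mult P 0 k")
  case True
  have "N = CHAR('k)" if "Factorial_Ring.prime N" "fix_mult P 0 (k * N) \<noteq> fix_mult P 0 k" for N
  proof -
    have "(of_nat N :: 'k alg_closure) = 0"
      using fix_mult_mult_eq[OF assms(1) True, of N] that(2) by (auto simp: mult.commute)
    then have "CHAR('k) dvd N" by (simp add: of_nat_eq_0_iff_char_dvd)
    moreover have "CHAR('k) \<noteq> 1" by simp
    ultimately show ?thesis using that(1) by (auto simp: prime_nat_iff)
  qed
  then have "{N. Factorial_Ring.prime N \<and> fix_mult P 0 (k * N) \<noteq> fix_mult P 0 k} \<subseteq> {CHAR('k)}" by auto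
  then show ?thesis by (rule finite_subset) simp
next
  case False
  let ?S = "{N. Factorial_Ring.prime N \<and> fix_mult P 0 (k * N) \<noteq> fix_mult P 0 k}"
  have ek: "fix_mult P 0 k = 1" using False assms by simp
  then obtain \<mu> :: "'k alg_closure" where \<mu>: "\<And>j. 0 < j \<Longrightarrow> 2 \<le> fix_mult P (j * 0) (j * k) \<longleftrightarrow> \<mu> ^ j = 1"
    using fix_mult_multiplier[OF assms(1), of P 0] by auto
  have \<mu>1: "\<mu> \<noteq> 1" using \<mu>[of 1] False by simp
  have pw: "\<mu> ^ N = 1" if "N \<in> ?S" for N
  proof -
    have "0 < N" using that by (auto simp: prime_gt_0_nat)
    then have "2 \<le> fix_mult P 0 (N * k)" using fix_mult_mono[OF assms(1), of N P 0] ek that by (simp add: mult.commute)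
    then show ?thesis using \<mu>[OF \<open>0 < N\<close>] by simp
  qed
  have "N = N'" if "N \<in> ?S" "N' \<in> ?S" for N N'
  proof (rule ccontr)
    assume "N \<noteq> N'"
    then have "coprime N N'" using that by (simp add: primes_coprime)
    then show False using power_eq_1_coprime[OF _ pw[OF that(1)] pw[OF that(2)]] \<mu>1 that by (auto simp: prime_gt_0_nat)
  qed
  then show ?thesis by (metis (no_types, lifting) finite.emptyI finite.insertI finite_subset insertI1 subsetI ex_in_conv)
qed

text \<open>Two different such primes are coprime, so the period of P would be 1.\<close>

lemma finite_primes_period:
  assumes "fix_mult P 0 1 = 0"
  shows "finite {N. Factorial_Ring.prime N \<and> 0 < fix_mult P 0 N}" (is "finite ?S")
proof -
  have "N = N'" if "N \<in> ?S" "N' \<in> ?S" for N N'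
  proof (rule ccontr)
    assume "N \<noteq> N'"
    then have "coprime N N'" using that by (simp add: primes_coprime)
    then show False using fix_mult_0_1_pos[of N N' P] that assms by (auto simp: prime_gt_0_nat)
  qed
  then show ?thesis by (metis (no_types, lifting) finite.emptyI finite.insertI finite_subset insertI1 subsetI ex_in_conv)
qed

theorem finite_irreducible_prime:
  "finite {N. Factorial_Ring.prime N \<and> \<not> reducible2 (dynatomic \<phi> (p * N))}"
proof -
  \<comment> \<open>\<open>J 1\<close> and \<open>J p\<close> collect the primes at which a fixed
    point of \<open>\<phi>\<close> or \<open>\<phi>^p\<close> changes multiplicity; \<open>H\<close>
    below collects prime periods of points fixed by h but not by \<open>\<phi>\<close>. All are
    finite unions of finite sets.\<close>
  define J where "J k = (\<Union>P\<in>{P. 0 < fix_mult P 0 k}. {N. Factorial_Ring.prime N \<and> fix_mult P 0 (k * N) \<noteq> fix_mult P 0 k})" for k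
  define H where "H = (\<Union>P\<in>{P. 0 < fix_mult P 1 0 \<and> fix_mult P 0 1 = 0}. {N. Factorial_Ring.prime N \<and> 0 < fix_mult P 0 N})"
  have finJ: "finite (J k)" if "0 < k" for k
    unfolding J_def using that by (intro finite_UN_I sum_fix_mult(1) finite_primes_jump) auto
  have finH: "finite H"
    unfolding H_def
    by (intro finite_UN_I finite_subset[OF _ finite_fixed_h] finite_primes_period) auto
  have p0: "0 < p" using p_gt_1 by simp
  have "reducible2 (dynatomic \<phi> (p * N))"
    if N: "Factorial_Ring.prime N" "N \<notin> J 1" "N \<notin> J p" "N \<notin> H" "p < N" "3 \<le> N" for N
  proof (rule ccontr)
    assume irr: "\<not> reducible2 (dynatomic \<phi> (p * N))"
    have N0: "0 < N" using N by simp
    have co: "coprime p N" using N prime_p by (intro primes_coprime) auto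
    have as: "moebius_transform (fix_mult P 0) (p * N) = int (fix_mult P 0 (p * N)) + int (fix_mult P 0 1) - int (fix_mult P 0 p) - int (fix_mult P 0 N)" for P
      using moebius_transform_prime_prime[OF prime_p N(1)] N(5) by simp
    have J1: "fix_mult P 0 N = fix_mult P 0 1" if "0 < fix_mult P 0 1" for P
    proof -
      have "N \<notin> {N. Factorial_Ring.prime N \<and> fix_mult P 0 (1 * N) \<noteq> fix_mult P 0 1}"
        using that N(2) unfolding J_def by blast
      then show ?thesis using N(1) by simp
    qed
    have Jp: "fix_mult P 0 (p * N) = fix_mult P 0 p" if "0 < fix_mult P 0 p" for P
    proof -
      have "N \<notin> {N. Factorial_Ring.prime N \<and> fix_mult P 0 (p * N) \<noteq> fix_mult P 0 p}"
        using that N(3) unfolding J_def by blast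
      then show ?thesis using N(1) by simp
    qed
    have e1p: "fix_mult P 0 1 \<le> fix_mult P 0 p" for P using fix_mult_mono[of 1 p P 0] p0 by simp
    have ep: "fix_mult P 0 p \<le> fix_mult P 0 (p * N)" for P using fix_mult_mono[of p N P 0] p0 N0 by (simp add: mult.commute)
    have eN: "fix_mult P 0 N \<le> fix_mult P 0 (p * N)" for P using fix_mult_mono[of N p P 0] p0 N0 by simp
    have nn: "moebius_transform (fix_mult P 0) (p * N) \<ge> 0" for P
    \<comment> \<open>For a fixed point of \<open>\<phi>\<close> the four terms cancel in pairs. For
      any other point, p and N coprime leave at most one of the two negative terms, and the
      multiplicity at pN dominates it.\<close>
    proof (cases "0 < fix_mult P 0 1")
      case True
      then show ?thesis using J1[of P] Jp[of P] e1p[of P] by (simp add: as)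
    next
      case False
      then have "fix_mult P 0 p = 0 \<or> fix_mult P 0 N = 0" using fix_mult_0_1_pos[OF p0 N0 co, of P] by auto
      then show ?thesis using ep[of P] eN[of P] by (auto simp: as)
    qed
    define S where "S = {P. fix_mult P 1 N > 0}"
    have finS: "finite S" using sum_fix_mult(1)[OF N0] by (simp add: S_def)
    have bound: "fix_mult P 1 N \<le> fix_mult P 0 p" if "P \<in> S" for P
    proof -
      have e1: "0 < fix_mult P 1 N" using that by (simp add: S_def)
      have "\<not> 0 < moebius_transform (fix_mult P 0) (p * N)"
        using dynatomic_reducible[OF N(6) nn e1] irr by blast
      then have z: "moebius_transform (fix_mult P 0) (p * N) = 0" using nn[of P] by linarith
      have le: "fix_mult P 1 N \<le> fix_mult P 0 (p * N)" by (rule fix_mult_1_le_fix_mult_0[OF N0])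
      \<comment> \<open>Otherwise the vanishing transform makes \<open>\<phi>^N\<close> fix P; then
        so does h, and N would lie in \<open>H\<close>.\<close>
      have "0 < fix_mult P 0 p"
      proof (rule ccontr)
        assume "\<not> 0 < fix_mult P 0 p"
        then have "fix_mult P 0 1 = 0" "fix_mult P 0 p = 0" using e1p[of P] by auto
        moreover from this have "0 < fix_mult P 0 N" using z le e1 by (simp add: as)
        ultimately have "N \<in> H" using fix_mult_1_0_pos[OF N0 e1] N(1) by (auto simp: H_def)
        then show False using N(4) by simp
      qed
      then show ?thesis using Jp[of P] le by simp
    qed
    have "d ^ N + 1 = (\<Sum>P\<in>S. fix_mult P 1 N)" using sum_fix_mult(2)[OF N0] by (simp add: S_def)
    also have "\<dots> \<le> (\<Sum>P\<in>S. fix_mult P 0 p)" by (rule sum_mono[OF bound])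
    also have "\<dots> \<le> d ^ p + 1" using sum_fix_mult(3)[OF p0 finS] .
    finally have "d ^ N \<le> d ^ p" by simp
    then have "N \<le> p" using d2 by simp
    then show False using N(5) by simp
  qed
  note reducible = this
  have "{N. Factorial_Ring.prime N \<and> \<not> reducible2 (dynatomic \<phi> (p * N))} \<subseteq>
      J 1 \<union> J p \<union> H \<union> {..p} \<union> {..<3}"
  proof
    fix N assume "N \<in> {N. Factorial_Ring.prime N \<and> \<not> reducible2 (dynatomic \<phi> (p * N))}"
    then show "N \<in> J 1 \<union> J p \<union> H \<union> {..p} \<union> {..<3}"
      using reducible[of N] by (cases "p < N"; cases "3 \<le> N") auto
  qed
  then show ?thesis by (rule finite_subset) (use finJ p0 finH in auto)
qed

end

theorem mainTheorem3:
  fixes \<phi> :: "'k::field ratmap" and h :: "'k ^ 2 ^ 2" and d p :: nat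
  assumes "rational_map d \<phi>" and "d \<ge> 2"
    and "h \<in> carrier GL2"
    and "is_automorphism h \<phi>"
    and "Factorial_Ring.prime p" and "group.ord PGL2 (pgl_class h) = p"
    and "Fix h \<subseteq> rational_points"
  shows "(CHAR('k) = 0 \<longrightarrow>
            finite {N::nat. N > 0 \<and> \<not> reducible2 (dynatomic \<phi> (p * N))}) \<and>
         finite {N::nat. Factorial_Ring.prime N \<and> \<not> reducible2 (dynatomic \<phi> (p * N))}"
proof -
  interpret ratmap_automorphism \<phi> h d p
    using assms(1-6) by unfold_locales
  show ?thesis using finite_irreducible_char_0 finite_irreducible_prime by blast
qed

end
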